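(* Let $0\le z,z'\le n$, and let $\mu\vdash n-z$ and $\mu'\vdash n-z'$ be partitions. Define $(\mu,z)\trianglerighteq(\mu',z')$ to mean: $z<z'$, or $z=z'$ and $\mu\trianglelefteq\mu'$ (i.e. $\mu'$ dominates $\mu$ in the classical dominance order). Then the following are equivalent: (i) $(\mu,z)\trianglerighteq(\mu',z')$; (ii) $I_{(\mu,z)}\subset I_{(\mu',z')}$; (iii) $V(I_{(\mu',z')})\subset V(I_{(\mu,z)})$.
   Context: Standing assumptions: $r\ge 2$, and $K$ is an infinite field containing all $r$-th roots of unity (e.g. algebraically closed). For an ideal $J\subset K[x_1,\dots,x_n]$, $V(J)\subset K^n$ is its set of common zeros in $K^n$. Dominance order: for partitions $\lambda,\nu$ of the same integer, $\lambda\trianglelefteq\nu$ means $\lambda_1+\dots+\lambda_i\le\nu_1+\dots+\nu_i$ for all $i$ (so $(1,\dots,1)$ is the bottom and the one-row partition $(N)$ is the top). Classical Specht ideal: for a partition $\mu\vdash N$, $I_\mu\subset K[y_1,\dots,y_N]$ is the ideal generated by the Specht polynomials of all tableaux $T$ of shape $\mu$ (bijective fillings with $1,\dots,N$); the Specht polynomial of $T$ is the product over the columns of $T$ of the Vandermonde products $\prod(y_a-y_b)$ over pairs of entries $a,b$ in that column (one factor for each pair; empty products equal $1$). Definition of $I_{(\mu,z)}$: let $0\le z\le n$ and $\mu\vdash n-z$. For $S=\{i_1<\dots<i_{n-z}\}\subset\{1,\dots,n\}$, let $\phi_S:K[y_1,\dots,y_{n-z}]\to K[x_{i_1},\dots,x_{i_{n-z}}]$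 be the $K$-algebra homomorphism $y_j\mapsto x_{i_j}^r$, and let $X_S=(x_j:j\notin S)\subset K[x_1,\dots,x_n]$. Let $I_{\ge z+1}$ be the ideal of $K[x_1,\dots,x_n]$ generated by all squarefree monomials of degree $n-z$. Then $$I_{(\mu,z)}:=\Big[\bigcap_{S\subset\{1,\dots,n\},\,|S|=n-z}\big(X_S+\phi_S(I_\mu)\big)\Big]\cap I_{\ge z+1},$$ where $X_S+\phi_S(I_\mu)$ denotes the ideal of $K[x_1,\dots,x_n]$ generated by $X_S$ and $\phi_S(I_\mu)$. *)

theory Defs
  imports
    "HOL-Library.Poly_Mapping"
    "HOL-Library.FuncSet"
    "HOL-Computational_Algebra.Polynomial"
    "HOL-Algebra.Ideal"
begin

section \<open>Polynomials in variables indexed by natural numbers\<close>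

text \<open>
  An exponent vector is a finitely supported map \<^typ>\<open>nat \<Rightarrow>\<^sub>0 nat\<close>; a polynomial maps finitely many
  exponent vectors to nonzero coefficients. The polynomial ring in \<open>n\<close> variables is the subring
  \<open>mpoly_ring n\<close> of polynomials in which only variables with index in \<open>{1..n}\<close> occur, so all
  ideals below are ideals of that ring, with \<^const>\<open>genideal\<close> taken there.
\<close>

type_synonym 'k mpoly = "(nat \<Rightarrow>\<^sub>0 nat) \<Rightarrow>\<^sub>0 'k"

definition Var :: "nat \<Rightarrow> 'k::comm_ring_1 mpoly" where
  "Var i = Poly_Mapping.single (Poly_Mapping.single i 1) 1"

definition Const :: "'k::comm_ring_1 \<Rightarrow> 'k mpoly" where
  "Const c = Poly_Mapping.single 0 c"

definition mpoly_ring :: "nat \<Rightarrow> 'k::comm_ring_1 mpoly ring" where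
  "mpoly_ring n =
     \<lparr>carrier = {p. \<forall>m \<in> Poly_Mapping.keys p. Poly_Mapping.keys m \<subseteq> {1..n}},
      monoid.mult = (*), one = 1, ring.zero = 0, add = (+)\<rparr>"

text \<open>
  \<open>mpoly_aeval h f\<close> is the ring homomorphism that acts as the ring homomorphism \<open>h\<close> on
  coefficients and sends the \<open>i\<close>-th variable to \<open>f i\<close>.
\<close>

definition mpoly_aeval ::
    "('k::comm_ring_1 \<Rightarrow> 'a::comm_ring_1) \<Rightarrow> (nat \<Rightarrow> 'a) \<Rightarrow> 'k mpoly \<Rightarrow> 'a" where
  "mpoly_aeval h f p =
     (\<Sum>m \<in> Poly_Mapping.keys p.
        h (Poly_Mapping.lookup p m) *
        (\<Prod>i \<in> Poly_Mapping.keys m. f i ^ Poly_Mapping.lookup m i))"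

definition mpoly_eval :: "(nat \<Rightarrow> 'k::comm_ring_1) \<Rightarrow> 'k mpoly \<Rightarrow> 'k" where
  "mpoly_eval a = mpoly_aeval (\<lambda>c. c) a"

definition mpoly_subst :: "(nat \<Rightarrow> 'k::comm_ring_1 mpoly) \<Rightarrow> 'k mpoly \<Rightarrow> 'k mpoly" where
  "mpoly_subst f = mpoly_aeval Const f"

text \<open>Points of \<open>K\<^sup>n\<close> are functions on \<open>{1..n}\<close>, made unique by extensionality.\<close>

definition zero_set :: "nat \<Rightarrow> 'k::comm_ring_1 mpoly set \<Rightarrow> (nat \<Rightarrow> 'k) set" where
  "zero_set n J = {a \<in> {1..n} \<rightarrow>\<^sub>E UNIV. \<forall>p \<in> J. mpoly_eval a p = 0}"


section \<open>Partitions and Specht ideals\<close>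

definition is_partition :: "nat list \<Rightarrow> nat \<Rightarrow> bool" where
  "is_partition mu N \<longleftrightarrow> sorted_wrt (\<ge>) mu \<and> (\<forall>k \<in> set mu. 0 < k) \<and> sum_list mu = N"

text \<open>
  Only used for partitions of the same integer. Taking more parts than there are pads with zeros.
\<close>

definition dominated_by :: "nat list \<Rightarrow> nat list \<Rightarrow> bool" where
  "dominated_by la nu \<longleftrightarrow> (\<forall>i. sum_list (take i la) \<le> sum_list (take i nu))"

text \<open>Cells are pairs (row, column), counted from 0.\<close>

definition cells :: "nat list \<Rightarrow> (nat \<times> nat) set" where
  "cells mu = {(i, j). i < length mu \<and> j < mu ! i}"

definition is_tableau :: "nat list \<Rightarrow> (nat \<times> nat \<Rightarrow> nat) \<Rightarrow> bool" where
  "is_tableau mu T \<longleftrightarrow> bij_betw T (cells mu) {1..sum_list mu}"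

text \<open>
  Each pair of entries of a column contributes one factor, the upper entry coming first; the sign
  convention does not affect the ideal generated.
\<close>

definition specht_poly :: "nat list \<Rightarrow> (nat \<times> nat \<Rightarrow> nat) \<Rightarrow> 'k::comm_ring_1 mpoly" where
  "specht_poly mu T =
     (\<Prod>j \<in> snd ` cells mu.
        \<Prod>(i, i') \<in> {(i, i'). i < i' \<and> (i, j) \<in> cells mu \<and> (i', j) \<in> cells mu}.
          Var (T (i, j)) - Var (T (i', j)))"

definition specht_ideal :: "nat list \<Rightarrow> 'k::comm_ring_1 mpoly set" where
  "specht_ideal mu =
     genideal (mpoly_ring (sum_list mu)) {specht_poly mu T | T. is_tableau mu T}"


section \<open>The ideals attached to pairs of a partition and a number of zeros\<close>

text \<open>For \<open>S = {i\<^sub>1 < i\<^sub>2 < \<dots>}\<close>, \<open>phi r S\<close> sends the \<open>j\<close>-th variable to the \<open>r\<close>-th power of the \<open>i\<^sub>j\<close>-th.\<close>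

definition phi :: "nat \<Rightarrow> nat set \<Rightarrow> 'k::comm_ring_1 mpoly \<Rightarrow> 'k mpoly" where
  "phi r S = mpoly_subst (\<lambda>j. Var (sorted_list_of_set S ! (j - 1)) ^ r)"

definition X_ideal :: "nat \<Rightarrow> nat set \<Rightarrow> 'k::comm_ring_1 mpoly set" where
  "X_ideal n S = genideal (mpoly_ring n) (Var ` ({1..n} - S))"

text \<open>\<open>many_zeros_ideal n z\<close> is the ideal written \<open>I\<close> with index \<open>\<ge> z + 1\<close>: its zeros are the points
  with at least \<open>z + 1\<close> vanishing coordinates.\<close>

definition many_zeros_ideal :: "nat \<Rightarrow> nat \<Rightarrow> 'k::comm_ring_1 mpoly set" where
  "many_zeros_ideal n z =
     genideal (mpoly_ring n) {\<Prod>i\<in>A. Var i | A. A \<subseteq> {1..n} \<and> card A = n - z}"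

definition I_ideal :: "nat \<Rightarrow> nat \<Rightarrow> nat list \<times> nat \<Rightarrow> 'k::comm_ring_1 mpoly set" where
  "I_ideal r n = (\<lambda>(mu, z).
     (\<Inter>S \<in> {S. S \<subseteq> {1..n} \<and> card S = n - z}.
        genideal (mpoly_ring n) (X_ideal n S \<union> phi r S ` specht_ideal mu))
     \<inter> many_zeros_ideal n z)"

text \<open>Note the direction: the larger pair has fewer zeros or the dominated partition.\<close>

definition pair_dominates :: "nat list \<times> nat \<Rightarrow> nat list \<times> nat \<Rightarrow> bool" where
  "pair_dominates = (\<lambda>(mu, z) (mu', z'). z < z' \<or> z = z' \<and> dominated_by mu mu')"

text \<open>
  All \<open>r\<close>-th roots of unity lie in the field: \<open>X\<^sup>r - 1\<close> splits into linear factors. They need not be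
  \<open>r\<close> distinct elements, so every algebraically closed field qualifies in any characteristic.
\<close>

definition contains_roots_of_unity :: "'k::field itself \<Rightarrow> nat \<Rightarrow> bool" where
  "contains_roots_of_unity _ r \<longleftrightarrow>
     (\<exists>zs :: 'k list. Polynomial.monom 1 r - 1 = (\<Prod>z\<leftarrow>zs. [:- z, 1:]))"

end

theory Submission
  imports Defs
begin

text \<open>
  If \<open>z < z'\<close>, every squarefree monomial of degree \<open>n - z\<close> involves a variable outside each set of size
  \<open>n - z'\<close>. If \<open>z = z'\<close>, the inclusion reduces to one of Specht ideals. Up to sign a Specht polynomial
  is the product of the Vandermonde products of the classes of a set partition (the columns), and for
  disjoint \<open>A\<close>, \<open>B\<close> with \<open>card B < card A\<close> Lagrange interpolation writes the product for the classes \<open>A\<close>, \<open>B\<close>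
  as a combination of those for \<open>A - {x}\<close>, \<open>insert x B\<close> with \<open>x \<in> A\<close>. Repeating this moves boxes until the
  dominating shape is reached.

  Conversely, take a point with exactly \<open>z\<close> zeros such that the \<open>r\<close>-th powers of its other coordinates
  take the \<open>i\<close>-th of infinitely many values with multiplicity \<open>mu ! i\<close>. It is never a zero of the ideal
  of \<open>(mu, z)\<close>, as one sees from a single Specht polynomial times the product of the nonzero
  coordinates; if it is not a zero of the ideal of \<open>(mu', z')\<close> either, then \<open>z < z'\<close>, or \<open>z = z'\<close> and some
  tableau of shape \<open>mu'\<close> has distinct values in each column, so \<open>mu'\<close> dominates \<open>mu\<close> by the pigeonhole
  principle.
\<close>

section \<open>Vandermonde products\<close>

text \<open>\<open>vander\<close> orders the pairs by index, a tableau orders them by row, so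
  products over the same column agree only up to sign. Ideals do not see the difference.\<close>

definition sgn_eq :: "'a::comm_ring_1 \<Rightarrow> 'a \<Rightarrow> bool" where
  "sgn_eq p q \<longleftrightarrow> p = q \<or> p = - q"

lemma sgn_eq_refl [simp]: "sgn_eq p p"
  by (simp add: sgn_eq_def)

lemma sgn_eq_sym: "sgn_eq p q \<Longrightarrow> sgn_eq q p"
  by (auto simp: sgn_eq_def)

lemma sgn_eq_trans [trans]: "sgn_eq p q \<Longrightarrow> sgn_eq q s \<Longrightarrow> sgn_eq p s"
  by (auto simp: sgn_eq_def)

lemma sgn_eq_mult: "sgn_eq p q \<Longrightarrow> sgn_eq p' q' \<Longrightarrow> sgn_eq (p * p') (q * q')"
  by (auto simp: sgn_eq_def)

lemma sgn_eq_prod: "(\<And>x. x \<in> A \<Longrightarrow> sgn_eq (f x) (g x)) \<Longrightarrow> sgn_eq (prod f A) (prod g A)"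
  by (induction A rule: infinite_finite_induct) (auto intro: sgn_eq_mult)

lemma sgn_eqE:
  assumes "sgn_eq p q"
  obtains s where "s \<in> {1, -1}" "p = s * q"
proof -
  from assms have "p = 1 * q \<or> p = - 1 * q" by (simp add: sgn_eq_def)
  then show ?thesis using that by blast
qed

definition vander :: "(nat \<Rightarrow> 'a::comm_ring_1) \<Rightarrow> nat set \<Rightarrow> 'a" where
  "vander v A = (\<Prod>(a, b) \<in> {(a, b). a < b \<and> a \<in> A \<and> b \<in> A}. v a - v b)"

lemma vander_empty [simp]: "vander v {} = 1"
  by (simp add: vander_def)

text \<open>The new pairs are those containing \<open>x\<close>; each is oriented by the order of
  the indices, so its factor is \<open>v x - v y\<close> or the negative of that.\<close>

lemma vander_insert:
  assumes "finite A" "x \<notin> A"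
  shows "sgn_eq (vander v (insert x A)) (vander v A * (\<Prod>y\<in>A. v x - v y))"
proof -
  let ?P = "{(a, b). a < b \<and> a \<in> A \<and> b \<in> A}"
  let ?g = "\<lambda>y. if x < y then (x, y) else (y, x)"
  have pairs: "{(a, b). a < b \<and> a \<in> insert x A \<and> b \<in> insert x A} = ?P \<union> ?g ` A"
    using assms by (auto simp: image_iff) (metis linorder_neqE_nat)+
  have "finite ?P"
    by (rule finite_subset[of _ "A \<times> A"]) (use assms in auto)
  moreover have "?P \<inter> ?g ` A = {}"
    using assms by auto
  ultimately have "vander v (insert x A) = vander v A * (\<Prod>(a, b)\<in>?g ` A. v a - v b)"
    unfolding vander_def pairs using assms by (subst prod.union_disjoint) auto
  also have "(\<Prod>(a, b)\<in>?g ` A. v a - v b) = (\<Prod>y\<in>A. case ?g y of (a, b) \<Rightarrow> v a - v b)"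
    by (subst prod.reindex) (auto simp: inj_on_def split: if_splits)
  finally show ?thesis
    by (simp only:) (intro sgn_eq_mult sgn_eq_prod sgn_eq_refl, simp add: sgn_eq_def)
qed

text \<open>Serves to pass from the row indices of a column to its entries. As \<open>g\<close> need
  not be monotone, pairs can flip; peeling off one element on both sides with
  \<open>vander_insert\<close> keeps control of the sign.\<close>

lemma vander_reindex:
  assumes "finite C" "inj_on g C"
  shows "sgn_eq (vander (v \<circ> g) C) (vander v (g ` C))"
  using assms
proof (induction C rule: finite_induct)
  case (insert x C)
  have "sgn_eq (vander (v \<circ> g) (insert x C)) (vander (v \<circ> g) C * (\<Prod>y\<in>C. v (g x) - v (g y)))"
    using vander_insert[OF insert(1,2), of "v \<circ> g"] by simp
  also have "sgn_eq \<dots> (vander v (g ` C) * (\<Prod>y\<in>g ` C. v (g x) - v y))"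
    using insert by (intro sgn_eq_mult) (simp_all add: prod.reindex[of g C] del: o_apply, simp_all)
  also have "sgn_eq \<dots> (vander v (insert (g x) (g ` C)))"
    using insert by (intro sgn_eq_sym[OF vander_insert]) auto
  finally show ?case by (simp only: image_insert)
qed simp

lemma degree_prod_linear:
  "degree (\<Prod>y\<in>A. [:- v y, 1:] :: 'a::idom poly) = card A"
  by (cases "finite A") (simp_all add: degree_prod_eq_sum_degree)

lemma coeff_prod_linear:
  "coeff (\<Prod>y\<in>A. [:- v y, 1:] :: 'a::idom poly) (card A) = 1"
  using lead_coeff_prod[of "\<lambda>y. [:- v y, 1:] :: 'a poly" A] by (simp add: degree_prod_linear)

text \<open>Lagrange interpolation through the points \<open>v x\<close> recovers the monic polynomial
  \<open>X ^ (card A - Suc (card B)) * (\<Prod>y\<in>B. X - v y)\<close>; the identity compares leading coefficients.\<close>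

lemma vander_exchange:
  fixes v :: "nat \<Rightarrow> 'a::idom"
  assumes fin: "finite A" "finite B" and disj: "A \<inter> B = {}" and inj: "inj_on v A"
    and less: "card B < card A"
  shows "\<exists>e. (\<forall>x\<in>A. e x \<in> {1, -1}) \<and> vander v A * vander v B =
    (\<Sum>x\<in>A. e x * v x ^ (card A - Suc (card B)) * (vander v (A - {x}) * vander v (insert x B)))"
proof -
  \<comment> \<open>This exponent gives \<open>f\<close> degree \<open>card A - 1\<close>, the
    largest that \<open>card A\<close> interpolation points determine.\<close>
  define k where "k = card A - Suc (card B)"
  define f where "f = monom 1 k * (\<Prod>y\<in>B. [:- v y, 1:])"
  have degf: "degree f = card A - 1"
    unfolding f_def using less
    by (subst degree_mult_eq) (auto simp: degree_monom_eq degree_prod_linear k_def fin prod_zero_iff)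
  have lcf: "coeff f (card A - 1) = 1"
    unfolding degf[symmetric] unfolding f_def lead_coeff_mult
    by (simp add: degree_prod_linear coeff_prod_linear degree_monom_eq)
  have evf: "poly f t = t ^ k * (\<Prod>y\<in>B. t - v y)" for t
    by (simp add: f_def poly_monom poly_prod)
  have "\<exists>s. s \<in> {1, -1} \<and> vander v A = s * (vander v (A - {x}) * (\<Prod>y\<in>A-{x}. v x - v y))"
    if "x \<in> A" for x
    using vander_insert[of "A - {x}" x v] that fin by (auto simp: insert_absorb elim!: sgn_eqE)
  then obtain s where s: "\<And>x. x \<in> A \<Longrightarrow> s x \<in> {1, -1}"
    "\<And>x. x \<in> A \<Longrightarrow> vander v A = s x * (vander v (A - {x}) * (\<Prod>y\<in>A-{x}. v x - v y))"
    by metis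
  have "\<exists>t. t \<in> {1, -1} \<and> vander v B * (\<Prod>y\<in>B. v x - v y) = t * vander v (insert x B)"
    if "x \<in> A" for x
    using sgn_eq_sym[OF vander_insert[of B x v]] that fin disj by (auto elim!: sgn_eqE)
  then obtain t where t: "\<And>x. x \<in> A \<Longrightarrow> t x \<in> {1, -1}"
    "\<And>x. x \<in> A \<Longrightarrow> vander v B * (\<Prod>y\<in>B. v x - v y) = t x * vander v (insert x B)"
    by metis
  define l where "l x = (\<Prod>y\<in>A-{x}. [:- v y, 1:])" for x
  \<comment> \<open>\<open>s x * vander v (A - {x})\<close> is \<open>vander v A\<close> divided by
    the denominator of the Lagrange basis polynomial at \<open>v x\<close>; interpolating
    \<open>vander v A\<close> times \<open>f\<close> thus avoids fractions.\<close>
  define c where "c x = s x * poly f (v x) * vander v (A - {x})" for x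
  define Q where "Q = (\<Sum>x\<in>A. smult (c x) (l x))"
  have degl: "degree (l x) = card A - 1" "coeff (l x) (card A - 1) = 1" if "x \<in> A" for x
    using degree_prod_linear[of v "A - {x}"] coeff_prod_linear[of v "A - {x}"] that fin
    by (simp_all add: l_def)
  \<comment> \<open>Both sides have degree below \<open>card A\<close> and agree at the
    \<open>card A\<close> distinct points \<open>v x\<close>.\<close>
  have "Q = smult (vander v A) f"
  proof (rule poly_eqI_degree)
    fix u assume "u \<in> v ` A"
    then obtain x where x: "x \<in> A" "u = v x" by auto
    have "poly (l y) (v x) = 0" if "y \<in> A" "y \<noteq> x" for y
      using that x fin by (auto simp: l_def poly_prod intro!: prod_zero)
    then have "poly Q (v x) = c x * poly (l x) (v x)"
      using fin x by (simp add: Q_def poly_sum sum.remove[of A x])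
    also have "\<dots> = poly f (v x) * vander v A"
      by (subst s(2)[OF x(1)]) (simp add: c_def l_def poly_prod algebra_simps)
    finally show "poly Q u = poly (smult (vander v A) f) u"
      using x by simp
  next
    have "degree Q \<le> card A - 1"
      unfolding Q_def using fin degl
      by (intro degree_sum_le) (auto intro: order.trans[OF degree_smult_le])
    then show "degree Q < card (v ` A)"
      using less inj by (simp add: card_image)
    show "degree (smult (vander v A) f) < card (v ` A)"
      using less inj degf degree_smult_le[of "vander v A" f] by (simp add: card_image)
  qed
  from arg_cong[OF this, of "\<lambda>p. coeff p (card A - 1)"] have "vander v A = (\<Sum>x\<in>A. c x)"
    using degl lcf by (simp add: Q_def coeff_sum)
  then have "vander v A * vander v B = (\<Sum>x\<in>A. c x * vander v B)"
    by (simp add: sum_distrib_right)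
  also have "\<dots> = (\<Sum>x\<in>A. s x * t x * v x ^ k * (vander v (A - {x}) * vander v (insert x B)))"
  proof (rule sum.cong)
    fix x assume x: "x \<in> A"
    have "c x * vander v B
      = s x * v x ^ k * vander v (A - {x}) * (vander v B * (\<Prod>y\<in>B. v x - v y))"
      by (simp add: c_def evf algebra_simps)
    also have "\<dots> = s x * t x * v x ^ k * (vander v (A - {x}) * vander v (insert x B))"
      unfolding t(2)[OF x] by (simp add: algebra_simps)
    finally show "c x * vander v B = \<dots>" .
  qed simp
  finally show ?thesis
    using s(1) t(1) unfolding k_def by (intro exI[of _ "\<lambda>x. s x * t x"]) fastforce
qed

section \<open>Moving boxes between columns\<close>

text \<open>A function on \<open>{1..N}\<close> encodes a tableau up to the order within columns and the order of the
  columns: its classes are the columns, \<open>height\<close> their lengths and \<open>rows\<close> the row lengths.\<close>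

definition height :: "nat \<Rightarrow> (nat \<Rightarrow> nat) \<Rightarrow> nat \<Rightarrow> nat" where
  "height N f j = card {x \<in> {1..N}. f x = j}"

definition rows :: "nat \<Rightarrow> (nat \<Rightarrow> nat) \<Rightarrow> nat \<Rightarrow> nat" where
  "rows N f t = card {j. t < height N f j}"

definition class_poly :: "nat \<Rightarrow> (nat \<Rightarrow> 'a::comm_ring_1) \<Rightarrow> (nat \<Rightarrow> nat) \<Rightarrow> 'a" where
  "class_poly N v f = (\<Prod>j \<in> f ` {1..N}. vander v {x \<in> {1..N}. f x = j})"

lemma class_poly_superset:
  assumes "finite J" "f ` {1..N} \<subseteq> J"
  shows "class_poly N v f = (\<Prod>j \<in> J. vander v {x \<in> {1..N}. f x = j})"
  unfolding class_poly_def
proof (rule prod.mono_neutral_left)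
  show "\<forall>j\<in>J - f ` {1..N}. vander v {x \<in> {1..N}. f x = j} = 1"
  proof
    fix j assume "j \<in> J - f ` {1..N}"
    then have "{x \<in> {1..N}. f x = j} = {}" by auto
    then show "vander v {x \<in> {1..N}. f x = j} = 1" by (simp only: vander_empty)
  qed
qed (use assms in auto)

lemma height_pos_iff: "0 < height N f j \<longleftrightarrow> j \<in> f ` {1..N}"
  by (auto simp: height_def card_gt_0_iff)

lemma finite_height_greater [simp]: "finite {j. t < height N f j}"
proof (rule finite_subset)
  show "{j. t < height N f j} \<subseteq> f ` {1..N}"
    unfolding height_pos_iff[symmetric] subset_iff by (metis gr_zeroI mem_Collect_eq not_less_zero height_pos_iff)
qed simp

lemma height_le: "height N f j \<le> N"
proof -
  have "height N f j \<le> card {1..N}"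
    unfolding height_def by (intro card_mono) auto
  then show ?thesis by simp
qed

lemma rows_eq_0:
  assumes "N \<le> t"
  shows "rows N f t = 0"
proof -
  have "\<not> t < height N f j" for j
    using height_le[of N f j] assms by simp
  then show ?thesis by (simp add: rows_def)
qed

text \<open>Double counting of the pairs \<open>(t, j)\<close> with \<open>t < height N f j\<close>:
  for fixed \<open>j\<close> they count a class, and the classes partition
  \<open>{1..N}\<close>.\<close>

lemma sum_rows: "(\<Sum>t<N. rows N f t) = N"
proof -
  have "(\<Sum>t<N. rows N f t) = (\<Sum>t<N. \<Sum>j\<in>f ` {1..N}. if t < height N f j then 1 else 0)"
  proof (rule sum.cong)
    fix t
    have "{j. t < height N f j} = {j \<in> f ` {1..N}. t < height N f j}"
      using height_pos_iff[of N f] by force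
    then show "rows N f t = (\<Sum>j\<in>f ` {1..N}. if t < height N f j then 1 else 0)"
      by (simp add: rows_def sum.If_cases Int_def)
  qed simp
  also have "\<dots> = (\<Sum>j\<in>f ` {1..N}. \<Sum>t<N. if t < height N f j then 1 else 0)"
    by (rule sum.swap)
  also have "\<dots> = (\<Sum>j\<in>f ` {1..N}. height N f j)"
  proof (rule sum.cong)
    fix j
    have "{..<N} \<inter> {t. t < height N f j} = {..<height N f j}"
      using height_le[of N f j] by auto
    then show "(\<Sum>t<N. if t < height N f j then 1 else 0) = height N f j"
      by (simp add: sum.If_cases)
  qed simp
  also have "\<dots> = card (\<Union>j\<in>f ` {1..N}. {x \<in> {1..N}. f x = j})"
    unfolding height_def by (subst card_UN_disjoint) auto
  also have "(\<Union>j\<in>f ` {1..N}. {x \<in> {1..N}. f x = j}) = {1..N}"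
    by auto
  finally show ?thesis by simp
qed

lemma sum_rows_ge:
  assumes "N \<le> t"
  shows "(\<Sum>s<t. rows N f s) = N"
proof -
  have "(\<Sum>s<t. rows N f s) = (\<Sum>s<N. rows N f s)"
    by (rule sum.mono_neutral_right) (use assms rows_eq_0 in auto)
  then show ?thesis by (simp add: sum_rows)
qed

lemma height_fun_upd:
  assumes "x \<in> {1..N}" "f x \<noteq> q"
  shows "height N (f(x := q)) j =
    (if j = f x then height N f j - 1 else if j = q then height N f j + 1 else height N f j)"
proof -
  have "{y \<in> {1..N}. (f(x := q)) y = f x} = {y \<in> {1..N}. f y = f x} - {x}"
    "{y \<in> {1..N}. (f(x := q)) y = q} = insert x {y \<in> {1..N}. f y = q}"
    using assms by auto
  moreover have "{y \<in> {1..N}. (f(x := q)) y = j} = {y \<in> {1..N}. f y = j}" if "j \<noteq> f x" "j \<noteq> q"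
    using that by auto
  ultimately show ?thesis
    using assms unfolding height_def by auto
qed

text \<open>Used to count the columns longer than \<open>t\<close> while treating the two columns
  changed by a move apart from the rest.\<close>

lemma card_add_two:
  assumes "finite R" "p \<noteq> q"
  shows "card (R - {p, q} \<union> ({j. P \<and> j = p} \<union> {j. Q \<and> j = q})) =
    card (R - {p, q}) + ((if P then 1 else 0) + (if Q then 1 else 0))"
proof -
  have "{j. P \<and> j = p} = (if P then {p} else {})" "{j. Q \<and> j = q} = (if Q then {q} else {})"
    by auto
  then show ?thesis
    using assms by (simp add: card_insert_if del: Collect_conv_if2)
qed

text \<open>The move removes the last box of column \<open>f x\<close>, in row
  \<open>height N f (f x) - 1\<close>, and adds a box at the end of column \<open>q\<close>, in row
  \<open>height N f q\<close>. Correction terms on both sides avoid truncated subtraction.\<close>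

lemma rows_fun_upd:
  assumes x: "x \<in> {1..N}" and less: "height N f q < height N f (f x)"
  shows "rows N (f(x := q)) t + (if t = height N f (f x) - 1 then 1 else 0) =
    rows N f t + (if t = height N f q then 1 else 0)"
proof -
  let ?a = "height N f (f x)" and ?b = "height N f q"
  have q: "f x \<noteq> q" using less by auto
  have a: "?a > 0" using less by simp
  let ?R = "{j. t < height N f j} - {f x, q}"
  have fin: "finite {j. t < height N f j}" by simp
  have "{j. t < height N (f(x := q)) j} =
      ?R \<union> ({j. t < ?a - 1 \<and> j = f x} \<union> {j. t \<le> ?b \<and> j = q})"
  proof (rule Set.set_eqI)
    fix j
    have "height N (f(x := q)) j = (if j = f x then ?a - 1 else if j = q then ?b + 1 else height N f j)"
      unfolding height_fun_upd[where f = f, OF x q] by simp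
    then show "j \<in> {j. t < height N (f(x := q)) j} \<longleftrightarrow>
        j \<in> ?R \<union> ({j. t < ?a - 1 \<and> j = f x} \<union> {j. t \<le> ?b \<and> j = q})"
      using q by (cases "j = f x"; cases "j = q") (simp_all del: fun_upd_apply add: less_Suc_eq_le)
  qed
  then have 1: "rows N (f(x := q)) t = card ?R + ((if t < ?a - 1 then 1 else 0) + (if t \<le> ?b then 1 else 0))"
    unfolding rows_def by (simp only: card_add_two[OF fin q])
  have "{j. t < height N f j} = ?R \<union> ({j. t < ?a \<and> j = f x} \<union> {j. t < ?b \<and> j = q})"
    by auto
  from arg_cong[OF this, of card]
  have 2: "rows N f t = card ?R + ((if t < ?a then 1 else 0) + (if t < ?b then 1 else 0))"
    unfolding rows_def by (simp only: card_add_two[OF fin q])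
  show ?thesis unfolding 1 2 using a less by auto
qed

text \<open>The added box enters the prefix sums from \<open>t = height N f q + 1\<close> on, and
  the removed one cancels it from \<open>t = height N f (f x)\<close> on.\<close>

lemma sum_rows_fun_upd:
  assumes "x \<in> {1..N}" "height N f q < height N f (f x)"
  shows "(\<Sum>s<t. rows N (f(x := q)) s) =
    (\<Sum>s<t. rows N f s) + (if height N f q < t \<and> t < height N f (f x) then 1 else 0)"
proof (induction t)
  case (Suc t)
  \<comment> \<open>The induction step in bare arithmetic: \<open>A\<close>, \<open>R\<close> stand
    for the old prefix sum and row length, \<open>A'\<close>, \<open>R'\<close> for the new ones,
    \<open>a\<close>, \<open>b\<close> for the two column lengths.\<close>
  have "A' + R' = A + R + (if b < Suc t \<and> Suc t < a then 1 else 0)"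
    if "R' + (if t = a - 1 then 1 else 0) = R + (if t = b then 1 else 0)"
      "A' = A + (if b < t \<and> t < a then 1 else 0)" "b < a" for A A' R R' a b :: nat
    using that by (auto split: if_splits)
  from this[OF rows_fun_upd[where f = f, OF assms, of t] Suc assms(2)] show ?case
    unfolding sum.lessThan_Suc .
qed simp

text \<open>This is \<open>vander_exchange\<close> for the classes of \<open>p\<close> and
  \<open>q\<close>; moving \<open>x\<close> leaves all other classes as they are, so their product
  \<open>W\<close> factors out.\<close>

lemma class_poly_fun_upd:
  fixes v :: "nat \<Rightarrow> 'a::idom"
  assumes inj: "inj_on v {1..N}" and less: "height N f q < height N f p"
  shows "\<exists>e. (\<forall>x. e x \<in> {1, -1}) \<and> class_poly N v f =
    (\<Sum>x | x \<in> {1..N} \<and> f x = p. e x * v x ^ (height N f p - Suc (height N f q)) * class_poly N v (f(x := q)))"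
proof -
  let ?C = "\<lambda>f j. {x \<in> {1..N}. f x = j}"
  \<comment> \<open>\<open>q\<close> is inserted because its class may be empty, \<open>p\<close>
    because its class may become empty after the move.\<close>
  let ?J = "insert p (insert q (f ` {1..N}))"
  define W where "W = (\<Prod>j\<in>?J - {p, q}. vander v (?C f j))"
  have pq: "p \<noteq> q" using less by auto
  have split: "(\<Prod>j\<in>?J. h j) = h p * h q * (\<Prod>j\<in>?J - {p, q}. h j)" for h :: "nat \<Rightarrow> 'a"
    using pq by (subst prod.remove[of _ p], simp, simp, subst prod.remove[of _ q])
      (simp_all only: Diff_insert2[symmetric] mult.assoc finite_insert finite_Diff insert_iff Diff_iff
        finite_imageI finite_atLeastAtMost simp_thms empty_iff)
  have f: "class_poly N v f = vander v (?C f p) * vander v (?C f q) * W"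
    by (subst class_poly_superset[of ?J], simp, blast, subst split) (simp add: W_def)
  have upd: "class_poly N v (f(x := q)) = vander v (?C f p - {x}) * vander v (insert x (?C f q)) * W"
    if "x \<in> ?C f p" for x
  proof -
    have C: "?C (f(x := q)) p = ?C f p - {x}" "?C (f(x := q)) q = insert x (?C f q)"
      using that pq by auto
    have "(\<Prod>j\<in>?J - {p, q}. vander v (?C (f(x := q)) j)) = W"
      unfolding W_def
    proof (rule prod.cong)
      fix j assume "j \<in> ?J - {p, q}"
      then have "?C (f(x := q)) j = ?C f j" using that by auto
      then show "vander v (?C (f(x := q)) j) = vander v (?C f j)" by (rule arg_cong)
    qed simp
    moreover have "f(x := q) ` {1..N} \<subseteq> ?J" using that by auto
    ultimately show ?thesis
      by (subst class_poly_superset[of ?J], simp, blast, subst split) (simp only: C)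
  qed
  have "\<exists>e. (\<forall>x\<in>?C f p. e x \<in> {1, -1}) \<and> vander v (?C f p) * vander v (?C f q) =
    (\<Sum>x\<in>?C f p. e x * v x ^ (card (?C f p) - Suc (card (?C f q))) *
      (vander v (?C f p - {x}) * vander v (insert x (?C f q))))"
  proof (rule vander_exchange)
    show "inj_on v (?C f p)" by (rule inj_on_subset[OF inj]) auto
    show "card (?C f q) < card (?C f p)" using less unfolding height_def .
  qed (use pq in auto)
  then obtain e where e: "\<forall>x\<in>?C f p. e x \<in> {1, -1}"
    "vander v (?C f p) * vander v (?C f q) =
    (\<Sum>x\<in>?C f p. e x * v x ^ (height N f p - Suc (height N f q)) *
      (vander v (?C f p - {x}) * vander v (insert x (?C f q))))"
    unfolding height_def by blast
  have "class_poly N v f = (\<Sum>x\<in>?C f p. e x * v x ^ (height N f p - Suc (height N f q)) * class_poly N v (f(x := q)))"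
    unfolding f e(2) sum_distrib_right by (rule sum.cong) (simp_all add: upd mult.assoc)
  \<comment> \<open>Outside the class of \<open>p\<close> the sign is set to the default 1.\<close>
  then show ?thesis
    using e(1) by (intro exI[of _ "\<lambda>x. if x \<in> ?C f p then e x else 1"] conjI allI) (simp_all split: if_split)
qed

text \<open>\<open>a\<close> is the first failure of \<open>P\<close> after \<open>t0\<close> and
  \<open>b\<close> the last one before it; they exist as \<open>P\<close> fails at \<open>N\<close>
  and at 0.\<close>

lemma gap_endpoints:
  fixes P :: "nat \<Rightarrow> bool"
  assumes "P t0" "\<not> P 0" "\<not> P N" "t0 < N"
  obtains a b where "b < t0" "t0 < a" "\<not> P a" "\<not> P b" "\<And>t. b < t \<Longrightarrow> t < a \<Longrightarrow> P t"
proof -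
  define a where "a = (LEAST t. t0 < t \<and> \<not> P t)"
  define b where "b = (GREATEST t. t < t0 \<and> \<not> P t)"
  have "t0 < N \<and> \<not> P N" using assms by simp
  then have a: "t0 < a \<and> \<not> P a" unfolding a_def by (rule LeastI)
  have "0 < t0 \<and> \<not> P 0" using assms by (cases t0) auto
  then have b: "b < t0 \<and> \<not> P b" unfolding b_def by (rule GreatestI_nat[where b = t0]) auto
  have "P t" if "b < t" "t < a" for t
  proof (rule ccontr)
    assume "\<not> P t"
    then have "t \<noteq> t0" using assms by auto
    then consider "t < t0" | "t0 < t" by linarith
    then show False
    proof cases
      case 1
      with \<open>\<not> P t\<close> have "t \<le> b" unfolding b_def by (intro Greatest_le_nat[where b = t0]) auto
      with that show False by simp
    next
      case 2
      with \<open>\<not> P t\<close> that show False unfolding a_def using not_less_Least by blast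
    qed
  qed
  with a b that show ?thesis by blast
qed

text \<open>Row \<open>t\<close> is longer than the next one because some column ends in it, and
  that column has length \<open>Suc t\<close>.\<close>

lemma ex_height_eq:
  assumes "rows N f (Suc t) < rows N f t"
  obtains j where "height N f j = Suc t"
proof -
  have "{j. t < height N f j} \<noteq> {j. Suc t < height N f j}"
    using assms unfolding rows_def by auto
  then obtain j where "t < height N f j" "\<not> Suc t < height N f j"
    using Suc_lessD by blast
  then show ?thesis using that[of j] by linarith
qed

text \<open>Where the prefix sums of \<open>rows N f\<close> are strictly too small on a maximal interval \<open>{b<..<a}\<close>,
  there are classes of sizes \<open>a\<close> and \<open>b\<close>, and moving one element from the first to the second
  raises the prefix sums by one exactly on that interval.\<close>

lemma class_poly_mem:
  fixes v :: "nat \<Rightarrow> 'a::idom"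
  assumes inj: "inj_on v {1..N}" and anti: "antimono \<rho>"
    and tot: "\<And>t. N \<le> t \<Longrightarrow> (\<Sum>s<t. \<rho> s) = N"
    and gen: "\<And>g. rows N g = \<rho> \<Longrightarrow> class_poly N v g \<in> J"
    and zero: "0 \<in> J" and add: "\<And>p q. p \<in> J \<Longrightarrow> q \<in> J \<Longrightarrow> p + q \<in> J"
    and mult: "\<And>e x k p. e \<in> {1, -1} \<Longrightarrow> x \<in> {1..N} \<Longrightarrow> p \<in> J \<Longrightarrow> e * v x ^ k * p \<in> J"
    and dom: "\<And>t. (\<Sum>s<t. rows N f s) \<le> (\<Sum>s<t. \<rho> s)"
  shows "class_poly N v f \<in> J"
  using dom
\<comment> \<open>The measure is the total deficit of the prefix sums, which every move of a box
  lowers.\<close>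
proof (induction "\<Sum>t<N. (\<Sum>s<t. \<rho> s) - (\<Sum>s<t. rows N f s)" arbitrary: f rule: less_induct)
  case less
  note dom = less.prems
  show ?case
  proof (cases "\<exists>t. (\<Sum>s<t. rows N f s) < (\<Sum>s<t. \<rho> s)")
    case False
    with dom have eq: "(\<Sum>s<t. rows N f s) = (\<Sum>s<t. \<rho> s)" for t
      using order.order_iff_strict by blast
    have "rows N f t = \<rho> t" for t
      using eq[of t] eq[of "Suc t"] by simp
    then show ?thesis using gen by blast
  next
    case True
    then obtain t0 where t0: "(\<Sum>s<t0. rows N f s) < (\<Sum>s<t0. \<rho> s)" by blast
    have "t0 < N"
      using t0 tot[of t0] sum_rows_ge[of N t0 f] by (cases "t0 < N") auto
    define P where "P t \<longleftrightarrow> (\<Sum>s<t. rows N f s) < (\<Sum>s<t. \<rho> s)" for t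
    have "P t0" "\<not> P 0" "\<not> P N"
      using t0 tot[of N] sum_rows[of N f] by (simp_all add: P_def)
    then obtain a b where ab: "b < t0" "t0 < a"
      and endp: "\<not> P a" "\<not> P b" and inside: "\<And>t. b < t \<Longrightarrow> t < a \<Longrightarrow> P t"
      by (rule gap_endpoints[OF _ _ _ \<open>t0 < N\<close>]) blast
    note endp = endp[unfolded P_def] and inside = inside[unfolded P_def]
    obtain a' where a': "a = Suc a'" using ab by (cases a) auto
    \<comment> \<open>At \<open>a\<close> the prefix sums agree and at \<open>a'\<close> that of
      \<open>f\<close> is too small, so row \<open>a'\<close> exceeds \<open>\<rho> a'\<close>. This
      is at least \<open>\<rho> a\<close>, which in turn bounds row \<open>a\<close>.\<close>
    have "rows N f (Suc a') < rows N f a'"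
      using inside[of a'] endp(1) dom[of a] dom[of "Suc a"] antimonoD[OF anti, of a' "Suc a'"] ab a'
      by simp
    then obtain p where p: "height N f p = a" using ex_height_eq a' by metis
    have "\<exists>q. height N f q = b"
    proof (cases b)
      case 0
      obtain q where "q \<notin> f ` {1..N}" by (meson ex_new_if_finite finite_atLeastAtMost finite_imageI infinite_UNIV_nat)
      then show ?thesis using height_pos_iff[of N f q] 0 by auto
    next
      case (Suc b')
      \<comment> \<open>Symmetrically, row \<open>b\<close> is shorter than \<open>\<rho> b\<close>,
        while row \<open>b'\<close> is at least \<open>\<rho> b'\<close> and hence longer than row
        \<open>b\<close>.\<close>
      have "rows N f (Suc b') < rows N f b'"
        using inside[of "Suc b"] endp(2) dom[of b] dom[of b'] antimonoD[OF anti, of b' "Suc b'"] ab Suc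
        by simp
      then show ?thesis using ex_height_eq Suc by metis
    qed
    then obtain q where q: "height N f q = b" by blast
    have less: "height N f q < height N f p" using p q ab by simp
    have mem: "class_poly N v (f(x := q)) \<in> J" if "x \<in> {1..N}" "f x = p" for x
    proof (rule less.hyps)
      note upd = sum_rows_fun_upd[of x N f q, unfolded that(2), OF that(1) less, unfolded p q]
      show dom': "(\<Sum>s<t. rows N (f(x := q)) s) \<le> (\<Sum>s<t. \<rho> s)" for t
        unfolding upd using dom[of t] inside[of t] by auto
      show "(\<Sum>t<N. (\<Sum>s<t. \<rho> s) - (\<Sum>s<t. rows N (f(x := q)) s))
        < (\<Sum>t<N. (\<Sum>s<t. \<rho> s) - (\<Sum>s<t. rows N f s))"
      proof (rule sum_strict_mono_ex1)
        \<comment> \<open>At \<open>t0\<close> the deficit drops strictly: it is positive there, and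
          \<open>t0\<close> lies inside the interval.\<close>
        show "\<exists>t\<in>{..<N}. (\<Sum>s<t. \<rho> s) - (\<Sum>s<t. rows N (f(x := q)) s) < (\<Sum>s<t. \<rho> s) - (\<Sum>s<t. rows N f s)"
          using \<open>t0 < N\<close> ab t0 by (intro bexI[of _ t0]) (auto simp: upd)
      qed (auto simp: upd)
    qed
    obtain e where e: "\<forall>x. e x \<in> {1, -1}" "class_poly N v f =
      (\<Sum>x | x \<in> {1..N} \<and> f x = p. e x * v x ^ (height N f p - Suc (height N f q)) * class_poly N v (f(x := q)))"
      using class_poly_fun_upd[OF inj less] by blast
    have sum_mem: "sum h F \<in> J" if "finite F" "\<And>x. x \<in> F \<Longrightarrow> h x \<in> J" for h :: "nat \<Rightarrow> 'a" and F
      using that by (induction F) (auto intro: zero add)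
    show ?thesis
      unfolding e(2)
    proof (rule sum_mem)
      fix x assume "x \<in> {x. x \<in> {1..N} \<and> f x = p}"
      then show "e x * v x ^ (height N f p - Suc (height N f q)) * class_poly N v (f(x := q)) \<in> J"
        using e(1) mem[of x] by (intro mult) blast+
    qed simp
  qed
qed

section \<open>The polynomial ring\<close>

lemma mpoly_carrier_iff:
  "p \<in> carrier (mpoly_ring n) \<longleftrightarrow> (\<forall>m \<in> Poly_Mapping.keys p. Poly_Mapping.keys m \<subseteq> {1..n})"
  by (simp add: mpoly_ring_def)

lemma mpoly_ring_simps [simp]:
  "monoid.mult (mpoly_ring n) = (*)" "one (mpoly_ring n) = 1"
  "ring.zero (mpoly_ring n) = 0" "ring.add (mpoly_ring n) = (+)"
  by (simp_all add: mpoly_ring_def)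

lemma mpoly_zero_closed [simp, intro]: "0 \<in> carrier (mpoly_ring n)"
  and mpoly_one_closed [simp, intro]: "1 \<in> carrier (mpoly_ring n)"
  by (simp_all add: mpoly_carrier_iff)

lemma mpoly_Const_closed [simp, intro]: "Const c \<in> carrier (mpoly_ring n)"
  by (simp add: mpoly_carrier_iff Const_def)

lemma mpoly_Var_closed [intro]: "i \<in> {1..n} \<Longrightarrow> Var i \<in> carrier (mpoly_ring n)"
  by (simp add: mpoly_carrier_iff Var_def)

lemma mpoly_uminus_closed [intro]:
  "p \<in> carrier (mpoly_ring n) \<Longrightarrow> - p \<in> carrier (mpoly_ring n)"
  by (simp add: mpoly_carrier_iff in_keys_iff)

lemma mpoly_add_closed [intro]:
  "p \<in> carrier (mpoly_ring n) \<Longrightarrow> q \<in> carrier (mpoly_ring n) \<Longrightarrow> p + q \<in> carrier (mpoly_ring n)"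
  using Poly_Mapping.keys_add[of p q] by (force simp: mpoly_carrier_iff)

lemma mpoly_diff_closed [intro]:
  "p \<in> carrier (mpoly_ring n) \<Longrightarrow> q \<in> carrier (mpoly_ring n) \<Longrightarrow> p - q \<in> carrier (mpoly_ring n)"
  using mpoly_add_closed[of p n "- q"] by auto

lemma mpoly_mult_closed [intro]:
  assumes "p \<in> carrier (mpoly_ring n)" "q \<in> carrier (mpoly_ring n)"
  shows "p * q \<in> carrier (mpoly_ring n)"
  unfolding mpoly_carrier_iff
proof
  fix m assume "m \<in> Poly_Mapping.keys (p * q)"
  then obtain a b where ab: "m = a + b" "a \<in> Poly_Mapping.keys p" "b \<in> Poly_Mapping.keys q"
    using Poly_Mapping.keys_mult[of p q] by blast
  then have "Poly_Mapping.keys a \<subseteq> {1..n}" "Poly_Mapping.keys b \<subseteq> {1..n}"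
    using assms by (auto simp: mpoly_carrier_iff)
  with Poly_Mapping.keys_add[of a b] show "Poly_Mapping.keys m \<subseteq> {1..n}"
    unfolding ab by blast
qed

lemma mpoly_power_closed [intro]:
  "p \<in> carrier (mpoly_ring n) \<Longrightarrow> p ^ k \<in> carrier (mpoly_ring n)"
  by (induction k) auto

lemma mpoly_sum_closed [intro]:
  "(\<And>x. x \<in> A \<Longrightarrow> f x \<in> carrier (mpoly_ring n)) \<Longrightarrow> sum f A \<in> carrier (mpoly_ring n)"
  by (induction A rule: infinite_finite_induct) auto

lemma mpoly_prod_closed [intro]:
  "(\<And>x. x \<in> A \<Longrightarrow> f x \<in> carrier (mpoly_ring n)) \<Longrightarrow> prod f A \<in> carrier (mpoly_ring n)"
  by (induction A rule: infinite_finite_induct) auto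

lemma cring_mpoly_ring: "cring (mpoly_ring n :: 'k::comm_ring_1 mpoly ring)"
proof (rule cringI)
  show "abelian_group (mpoly_ring n :: 'k mpoly ring)"
  proof (rule abelian_groupI, unfold mpoly_ring_simps)
    fix x :: "'k mpoly" assume "x \<in> carrier (mpoly_ring n)"
    then show "\<exists>y\<in>carrier (mpoly_ring n). y + x = 0"
      by (intro bexI[of _ "- x"]) auto
  qed (auto simp: add.assoc add.commute)
  show "comm_monoid (mpoly_ring n :: 'k mpoly ring)"
    by (rule comm_monoidI, unfold mpoly_ring_simps) (auto simp: mult.assoc mult.commute)
qed (simp add: distrib_right)

section \<open>Ideals of the polynomial ring\<close>

context
  fixes n :: nat and I :: "'k::comm_ring_1 mpoly set"
  assumes ideal: "ideal I (mpoly_ring n)"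
begin

lemma mpoly_ideal_zero: "0 \<in> I"
  using additive_subgroup.zero_closed[OF ideal.axioms(1)[OF ideal]] by simp

lemma mpoly_ideal_add: "p \<in> I \<Longrightarrow> q \<in> I \<Longrightarrow> p + q \<in> I"
  using additive_subgroup.a_closed[OF ideal.axioms(1)[OF ideal], of p q] by simp

lemma mpoly_ideal_mult: "p \<in> I \<Longrightarrow> c \<in> carrier (mpoly_ring n) \<Longrightarrow> c * p \<in> I"
  using ideal.I_l_closed[OF ideal, of p c] by simp

lemma mpoly_ideal_uminus: "p \<in> I \<Longrightarrow> - p \<in> I"
  using mpoly_ideal_mult[of p "- 1"] by auto

end

lemma ideal_genideal_mpoly:
  "S \<subseteq> carrier (mpoly_ring n) \<Longrightarrow> ideal (genideal (mpoly_ring n) S) (mpoly_ring n)"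
  by (rule ring.genideal_ideal[OF cring.axioms(1)[OF cring_mpoly_ring]])

lemma genideal_mpoly_self:
  "S \<subseteq> carrier (mpoly_ring n) \<Longrightarrow> S \<subseteq> genideal (mpoly_ring n) S"
  by (rule ring.genideal_self[OF cring.axioms(1)[OF cring_mpoly_ring]])

lemma genideal_mpoly_minimal:
  "ideal I (mpoly_ring n) \<Longrightarrow> S \<subseteq> I \<Longrightarrow> genideal (mpoly_ring n) S \<subseteq> I"
  by (rule ring.genideal_minimal[OF cring.axioms(1)[OF cring_mpoly_ring]])

lemma genideal_mpoly_mono:
  assumes "S \<subseteq> S'" "S' \<subseteq> carrier (mpoly_ring n)"
  shows "genideal (mpoly_ring n) S \<subseteq> genideal (mpoly_ring n) S'"
  by (rule genideal_mpoly_minimal[OF ideal_genideal_mpoly]) (use assms genideal_mpoly_self in blast)+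

section \<open>Evaluation at points and substitution\<close>

definition monom_eval :: "(nat \<Rightarrow> 'k::comm_ring_1) \<Rightarrow> (nat \<Rightarrow>\<^sub>0 nat) \<Rightarrow> 'k" where
  "monom_eval a m = (\<Prod>i \<in> Poly_Mapping.keys m. a i ^ Poly_Mapping.lookup m i)"

lemma monom_eval_superset:
  "finite F \<Longrightarrow> Poly_Mapping.keys m \<subseteq> F \<Longrightarrow> monom_eval a m = (\<Prod>i \<in> F. a i ^ Poly_Mapping.lookup m i)"
  unfolding monom_eval_def by (rule prod.mono_neutral_left) (auto simp: in_keys_iff)

lemma monom_eval_add: "monom_eval a (m + m') = monom_eval a m * monom_eval a m'"
proof -
  let ?F = "Poly_Mapping.keys m \<union> Poly_Mapping.keys m'"
  have "Poly_Mapping.keys (m + m') \<subseteq> ?F" by (rule Poly_Mapping.keys_add)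
  then show ?thesis
    by (simp add: monom_eval_superset[of ?F] lookup_add power_add prod.distrib)
qed

lemma mpoly_eval_eq:
  "mpoly_eval a p = (\<Sum>m \<in> Poly_Mapping.keys p. Poly_Mapping.lookup p m * monom_eval a m)"
  by (simp add: mpoly_eval_def mpoly_aeval_def monom_eval_def)

lemma mpoly_eval_single: "mpoly_eval a (Poly_Mapping.single m c) = c * monom_eval a m"
  by (simp add: mpoly_eval_eq)

lemma mpoly_eval_zero [simp]: "mpoly_eval a 0 = 0"
  by (simp add: mpoly_eval_eq)

lemma mpoly_eval_add [simp]: "mpoly_eval a (p + q) = mpoly_eval a p + mpoly_eval a q"
  unfolding mpoly_eval_eq by (rule setsum_keys_plus_distrib) (simp_all add: distrib_right)

lemma mpoly_eval_sum [simp]: "mpoly_eval a (sum f A) = (\<Sum>x\<in>A. mpoly_eval a (f x))"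
  by (induction A rule: infinite_finite_induct) auto

lemma mpoly_eval_Const [simp]: "mpoly_eval a (Const c) = c"
  by (simp add: Const_def mpoly_eval_single monom_eval_def)

lemma mpoly_eval_one [simp]: "mpoly_eval a 1 = 1"
  using mpoly_eval_Const[of a 1] by (simp add: Const_def)

lemma mpoly_eval_Var [simp]: "mpoly_eval a (Var i) = a i"
  by (simp add: Var_def mpoly_eval_single monom_eval_def)

lemma mpoly_sum_monomials:
  "p = (\<Sum>m \<in> Poly_Mapping.keys p. Poly_Mapping.single m (Poly_Mapping.lookup p m))"
  by (rule poly_mapping_eqI) (auto simp: lookup_sum lookup_single when_def sum.If_cases in_keys_iff)

text \<open>On monomials this is \<open>monom_eval_add\<close>; expanding both factors into
  monomials gives the rest.\<close>

lemma mpoly_eval_mult [simp]: "mpoly_eval a (p * q) = mpoly_eval a p * mpoly_eval a q"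
proof -
  have "mpoly_eval a (p * q) = mpoly_eval a
    ((\<Sum>m \<in> Poly_Mapping.keys p. Poly_Mapping.single m (Poly_Mapping.lookup p m)) *
     (\<Sum>m \<in> Poly_Mapping.keys q. Poly_Mapping.single m (Poly_Mapping.lookup q m)))"
    by (simp flip: mpoly_sum_monomials)
  also have "\<dots> = mpoly_eval a p * mpoly_eval a q"
    unfolding sum_product mpoly_eval_sum mult_single mpoly_eval_single monom_eval_add
    by (simp add: mpoly_eval_eq sum_product algebra_simps)
  finally show ?thesis .
qed

lemma mpoly_eval_diff [simp]: "mpoly_eval a (p - q) = mpoly_eval a p - mpoly_eval a q"
  using mpoly_eval_add[of a "p - q" q] by simp

lemma mpoly_eval_prod [simp]: "mpoly_eval a (prod f A) = (\<Prod>x\<in>A. mpoly_eval a (f x))"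
  by (induction A rule: infinite_finite_induct) auto

lemma mpoly_eval_power [simp]: "mpoly_eval a (p ^ k) = mpoly_eval a p ^ k"
  by (induction k) auto

lemma mpoly_carrierD:
  "p \<in> carrier (mpoly_ring n) \<Longrightarrow> m \<in> Poly_Mapping.keys p \<Longrightarrow> i \<in> Poly_Mapping.keys m \<Longrightarrow> i \<in> {1..n}"
  by (meson mpoly_carrier_iff subsetD)

lemma mpoly_eval_cong:
  assumes "p \<in> carrier (mpoly_ring n)" "\<And>i. i \<in> {1..n} \<Longrightarrow> a i = b i"
  shows "mpoly_eval a p = mpoly_eval b p"
  unfolding mpoly_eval_eq monom_eval_def
  using assms(2)[OF mpoly_carrierD[OF assms(1)]] by simp

lemma mpoly_eval_subst: "mpoly_eval a (mpoly_subst g p) = mpoly_eval (\<lambda>i. mpoly_eval a (g i)) p"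
  by (simp add: mpoly_subst_def mpoly_aeval_def mpoly_eval_eq[of _ p] monom_eval_def)

lemma mpoly_subst_closed:
  assumes "p \<in> carrier (mpoly_ring N)" "\<And>i. i \<in> {1..N} \<Longrightarrow> g i \<in> carrier (mpoly_ring n)"
  shows "mpoly_subst g p \<in> carrier (mpoly_ring n)"
  unfolding mpoly_subst_def mpoly_aeval_def
  by (intro mpoly_sum_closed mpoly_mult_closed mpoly_prod_closed mpoly_power_closed)
    (use assms(2)[OF mpoly_carrierD[OF assms(1)]] in auto)

text \<open>Bounds generated ideals from above: once the generators vanish on \<open>V\<close>,
  minimality makes the whole ideal vanish there.\<close>

lemma ideal_vanishing:
  "ideal {p \<in> carrier (mpoly_ring n). \<forall>a \<in> V. mpoly_eval a p = (0::'k::comm_ring_1)} (mpoly_ring n)"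
proof (rule idealI)
  let ?R = "mpoly_ring n :: 'k mpoly ring"
  interpret cring ?R by (rule cring_mpoly_ring)
  show "ring ?R" by (rule ring_axioms)
  show "subgroup {p \<in> carrier ?R. \<forall>a \<in> V. mpoly_eval a p = 0} (add_monoid ?R)"
  proof (rule add.subgroupI)
    fix p assume p: "p \<in> {p \<in> carrier ?R. \<forall>a \<in> V. mpoly_eval a p = 0}"
    then have "- p \<in> carrier ?R" "\<forall>a \<in> V. mpoly_eval a (- p) = 0"
      using mpoly_eval_diff[of _ 0 p] by auto
    moreover have "\<ominus>\<^bsub>?R\<^esub> p = - p"
      using p calculation(1) by (intro minus_equality) auto
    ultimately show "\<ominus>\<^bsub>?R\<^esub> p \<in> {p \<in> carrier ?R. \<forall>a \<in> V. mpoly_eval a p = 0}"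
      by simp
  next
    show "{p \<in> carrier ?R. \<forall>a \<in> V. mpoly_eval a p = 0} \<noteq> {}"
      by (rule ex_in_conv[THEN iffD1], rule exI[of _ 0]) simp
  qed (simp_all add: mpoly_add_closed subset_iff)
qed (simp_all add: mpoly_mult_closed)

section \<open>Tableaux and Specht ideals\<close>

text \<open>Padding with zeros makes the row lengths a total function, comparable with
  \<open>rows N f\<close>.\<close>

definition row :: "nat list \<Rightarrow> nat \<Rightarrow> nat" where
  "row mu i = (if i < length mu then mu ! i else 0)"

lemma mem_cells_iff: "(i, j) \<in> cells mu \<longleftrightarrow> j < row mu i"
  by (simp add: cells_def row_def)

lemma antimono_row:
  assumes "is_partition mu N"
  shows "antimono (row mu)"
proof (rule antimonoI)
  fix i k :: nat assume "i \<le> k"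
  then show "row mu k \<le> row mu i"
    using assms sorted_wrt_nth_less[of "(\<ge>)" mu i k]
    by (cases "i = k") (auto simp: row_def is_partition_def)
qed

lemma sum_list_take_eq: "sum_list (take t mu) = (\<Sum>s<t. row mu s)"
proof (induction t)
  case (Suc t)
  then show ?case by (cases "t < length mu") (simp_all add: row_def take_Suc_conv_app_nth)
qed simp

lemma sum_row_ge:
  assumes "is_partition mu N" "N \<le> t"
  shows "(\<Sum>s<t. row mu s) = N"
proof -
  \<comment> \<open>All parts are at least 1, so there are at most \<open>N\<close> of them and the
    first \<open>t\<close> parts are the whole list.\<close>
  have "length mu = (\<Sum>k\<leftarrow>mu. 1)" by (simp add: sum_list_triv)
  also have "\<dots> \<le> (\<Sum>k\<leftarrow>mu. k)"
    by (rule sum_list_mono) (use assms in \<open>auto simp: is_partition_def Suc_le_eq\<close>)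
  also have "\<dots> = N" using assms by (simp add: is_partition_def)
  finally have "take t mu = mu" using assms by simp
  then show ?thesis using assms sum_list_take_eq[of t mu] by (simp add: is_partition_def)
qed

lemma card_cells_less: "card {(i, j). (i, j) \<in> cells mu \<and> i < t} = (\<Sum>s<t. row mu s)"
proof -
  have "{(i, j). (i, j) \<in> cells mu \<and> i < t} = Sigma {..<t} (\<lambda>i. {..<row mu i})"
    by (auto simp: mem_cells_iff)
  then show ?thesis by simp
qed

lemma finite_cells [simp]: "finite (cells mu)"
proof -
  have "cells mu = Sigma {..<length mu} (\<lambda>i. {..<mu ! i})"
    by (auto simp: cells_def)
  then show ?thesis by simp
qed

lemma card_cells: "card (cells mu) = sum_list mu"
proof -
  have "cells mu = {(i, j). (i, j) \<in> cells mu \<and> i < length mu}"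
    by (auto simp: cells_def)
  then show ?thesis
    using card_cells_less[of mu "length mu"] sum_list_take_eq[of "length mu" mu] by simp
qed

lemma ex_tableau: "\<exists>T. is_tableau mu T"
  unfolding is_tableau_def by (rule finite_same_card_bij) (simp_all add: card_cells)

text \<open>Identifies columns, and later sets of ranks, as initial segments.\<close>

lemma down_closed_eq_lessThan:
  fixes A :: "nat set"
  assumes "finite A" and down: "\<And>x y. x \<in> A \<Longrightarrow> y < x \<Longrightarrow> y \<in> A"
  shows "A = {..<card A}"
proof -
  obtain n where "A = {..<n}"
  proof (cases "A = {}")
    case True
    then show ?thesis using that[of 0] by simp
  next
    case False
    have "A = {..<Suc (Max A)}"
    proof
      show "A \<subseteq> {..<Suc (Max A)}" using assms(1) by (auto simp: less_Suc_eq_le)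
      show "{..<Suc (Max A)} \<subseteq> A"
        using down[OF Max_in[OF assms(1) False]] Max_in[OF assms(1) False]
        by (auto simp: less_Suc_eq)
    qed
    then show ?thesis by (rule that)
  qed
  then show ?thesis by simp
qed

lemma column_eq_lessThan:
  assumes "is_partition mu N"
  shows "{i. (i, j) \<in> cells mu} = {..<card {i. (i, j) \<in> cells mu}}"
proof (rule down_closed_eq_lessThan)
  show "finite {i. (i, j) \<in> cells mu}"
    by (rule finite_subset[of _ "fst ` cells mu"]) force+
  fix x y assume "x \<in> {i. (i, j) \<in> cells mu}" "y < x"
  then show "y \<in> {i. (i, j) \<in> cells mu}"
    using antimonoD[OF antimono_row[OF assms], of y x] by (simp add: mem_cells_iff)
qed

text \<open>The classes of \<open>f\<close> are the columns, because \<open>c\<close> gives distinct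
  columns distinct labels. Labels other than the column index are allowed since
  \<open>tableau_of_rows\<close> produces them. The sign comes from \<open>vander_reindex\<close>,
  column by column.\<close>

lemma specht_poly_class_poly:
  assumes T: "is_tableau mu T" and inj: "inj_on c (snd ` cells mu)"
    and f: "\<And>i j. (i, j) \<in> cells mu \<Longrightarrow> f (T (i, j)) = c j"
  shows "sgn_eq (specht_poly mu T) (class_poly (sum_list mu) (Var :: nat \<Rightarrow> 'k::comm_ring_1 mpoly) f)"
proof -
  let ?N = "sum_list mu" and ?V = "Var :: nat \<Rightarrow> 'k mpoly"
  have bij: "inj_on T (cells mu)" "T ` cells mu = {1..?N}"
    using T by (auto simp: is_tableau_def bij_betw_def)
  have "f ` {1..?N} = c ` snd ` cells mu"
    unfolding bij(2)[symmetric] image_image by (rule image_cong) (use f in auto)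
  then have "class_poly ?N ?V f =
      (\<Prod>j\<in>snd ` cells mu. vander ?V {x \<in> {1..?N}. f x = c j})"
    by (simp add: class_poly_def prod.reindex[OF inj])
  moreover have "sgn_eq (specht_poly mu T :: 'k mpoly) (\<Prod>j\<in>snd ` cells mu. vander ?V {x \<in> {1..?N}. f x = c j})"
    unfolding specht_poly_def
  proof (rule sgn_eq_prod)
    fix j assume j: "j \<in> snd ` cells mu"
    let ?C = "{i. (i, j) \<in> cells mu}"
    have eq: "{x \<in> {1..?N}. f x = c j} = (\<lambda>i. T (i, j)) ` ?C"
    proof
      show "{x \<in> {1..?N}. f x = c j} \<subseteq> (\<lambda>i. T (i, j)) ` ?C"
      proof
        fix x assume x: "x \<in> {x \<in> {1..?N}. f x = c j}"
        then have "x \<in> T ` cells mu" using bij(2) by auto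
        then obtain i k where ik: "(i, k) \<in> cells mu" "x = T (i, k)" by auto
        with x f have "c k = c j" by auto
        moreover have "k \<in> snd ` cells mu" using ik(1) by force
        ultimately have "k = j" using inj j by (auto dest: inj_onD)
        with ik show "x \<in> (\<lambda>i. T (i, j)) ` ?C" by auto
      qed
      show "(\<lambda>i. T (i, j)) ` ?C \<subseteq> {x \<in> {1..?N}. f x = c j}"
        using f bij(2) by blast
    qed
    have "finite ?C" by (rule finite_subset[of _ "fst ` cells mu"]) force+
    moreover have "inj_on (\<lambda>i. T (i, j)) ?C" using bij(1) by (auto simp: inj_on_def)
    ultimately have "sgn_eq (vander (?V \<circ> (\<lambda>i. T (i, j))) ?C) (vander ?V {x \<in> {1..?N}. f x = c j})"
      unfolding eq by (rule vander_reindex)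
    then show "sgn_eq (\<Prod>(i, i')\<in>{(i, i'). i < i' \<and> (i, j) \<in> cells mu \<and> (i', j) \<in> cells mu}.
        ?V (T (i, j)) - ?V (T (i', j))) (vander ?V {x \<in> {1..?N}. f x = c j})"
      by (simp add: vander_def)
  qed
  ultimately show ?thesis by (simp only:)
qed

lemma rows_tableau:
  assumes mu: "is_partition mu N" and T: "is_tableau mu T"
    and f: "\<And>i j. (i, j) \<in> cells mu \<Longrightarrow> f (T (i, j)) = j"
  shows "rows N f = row mu"
proof
  fix t
  have N: "N = sum_list mu" using mu by (simp add: is_partition_def)
  have bij: "inj_on T (cells mu)" "T ` cells mu = {1..N}"
    using T N by (auto simp: is_tableau_def bij_betw_def)
  have "height N f j = card {i. (i, j) \<in> cells mu}" for j
  proof -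
    have "{x \<in> {1..N}. f x = j} = (\<lambda>i. T (i, j)) ` {i. (i, j) \<in> cells mu}"
      unfolding bij(2)[symmetric] using f by auto
    moreover have "inj_on (\<lambda>i. T (i, j)) {i. (i, j) \<in> cells mu}"
      using bij(1) by (auto simp: inj_on_def)
    ultimately show ?thesis by (simp add: height_def card_image)
  qed
  \<comment> \<open>Column \<open>j\<close> is an initial segment, so it meets row \<open>t\<close>
    exactly when it is longer than \<open>t\<close>.\<close>
  then have "t < height N f j \<longleftrightarrow> j < row mu t" for j
    using column_eq_lessThan[OF mu, of j] mem_cells_iff[of t j mu] by auto
  then show "rows N f t = row mu t" by (simp add: rows_def)
qed

section \<open>Building a tableau from a set partition\<close>

lemma ex_antimono_ranking:
  fixes h :: "'a \<Rightarrow> nat"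
  assumes "finite J"
  shows "\<exists>\<sigma>. bij_betw \<sigma> J {..<card J} \<and> (\<forall>j\<in>J. \<forall>k\<in>J. h j < h k \<longrightarrow> \<sigma> k < \<sigma> j)"
  using assms
\<comment> \<open>Elements are inserted by decreasing \<open>h\<close>, so the new one has the
  smallest value and takes the last rank, \<open>card S\<close>. The rule does not exclude that it
  already lies in \<open>S\<close>.\<close>
proof (induction J rule: finite_ranking_induct[where f = "\<lambda>j. - int (h j)"])
  case (insert x S)
  show ?case
  proof (cases "x \<in> S")
    case True
    then show ?thesis using insert by (simp add: insert_absorb)
  next
    case False
    obtain \<sigma> where \<sigma>: "bij_betw \<sigma> S {..<card S}" "\<And>j k. j \<in> S \<Longrightarrow> k \<in> S \<Longrightarrow> h j < h k \<Longrightarrow> \<sigma> k < \<sigma> j"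
      using insert by blast
    have "bij_betw (\<sigma>(x := card S)) S {..<card S}"
      using \<sigma>(1) False by (subst bij_betw_cong[of S _ \<sigma>]) auto
    then have "bij_betw (\<sigma>(x := card S)) (S \<union> {x}) ({..<card S} \<union> {card S})"
      by (rule bij_betw_combine) (auto simp: bij_betw_def)
    then have "bij_betw (\<sigma>(x := card S)) (insert x S) {..<card (insert x S)}"
      using False insert(1) by (simp add: lessThan_Suc)
    moreover have "\<sigma> k < card S" if "k \<in> S" for k
      using \<sigma>(1) that by (auto simp: bij_betw_def)
    ultimately show ?thesis
      using \<sigma>(2) insert(2) False by (intro exI[of _ "\<sigma>(x := card S)"]) force
  qed
qed (simp add: bij_betw_def)

text \<open>A converse of \<open>rows_tableau\<close>: ranking the classes by decreasing size makes
  them the columns, and each class is written down its column in some order.\<close>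

lemma tableau_of_rows:
  assumes mu: "is_partition mu N" and rows: "rows N f = row mu"
  obtains T c where "is_tableau mu T" "inj_on c (snd ` cells mu)"
    "\<And>i j. (i, j) \<in> cells mu \<Longrightarrow> f (T (i, j)) = c j"
proof -
  define J where "J = f ` {1..N}"
  have finJ: "finite J" by (simp add: J_def)
  obtain \<sigma> where bij: "bij_betw \<sigma> J {..<card J}"
    and anti: "\<And>j k. j \<in> J \<Longrightarrow> k \<in> J \<Longrightarrow> height N f j < height N f k \<Longrightarrow> \<sigma> k < \<sigma> j"
    using ex_antimono_ranking[OF finJ, of "height N f"] by blast
  have J: "j \<in> J" if "t < height N f j" for t j
    using that height_pos_iff[of N f j] unfolding J_def by linarith
  have inj: "inj_on \<sigma> J" and img: "\<sigma> ` J = {..<card J}"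
    using bij by (simp_all add: bij_betw_def)
  \<comment> \<open>Classes with more than \<open>t\<close> elements come first in the ranking and
    number \<open>row mu t\<close>, so they occupy exactly the columns that meet row
    \<open>t\<close>.\<close>
  have \<sigma>: "\<sigma> ` {j. t < height N f j} = {..<row mu t}" for t
  proof -
    have "\<sigma> ` {j. t < height N f j} = {..<card (\<sigma> ` {j. t < height N f j})}"
    proof (rule down_closed_eq_lessThan)
      fix x y assume "x \<in> \<sigma> ` {j. t < height N f j}" and yx: "y < x"
      then obtain j where j: "t < height N f j" "x = \<sigma> j" by blast
      have "x \<in> {..<card J}" using img J[OF j(1)] j(2) by blast
      then have "y \<in> \<sigma> ` J" using yx img by simp
      then obtain k where k: "k \<in> J" "y = \<sigma> k" by blast
      have "\<not> height N f k < height N f j"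
        using anti[OF k(1) J[OF j(1)]] yx j k by auto
      then show "y \<in> \<sigma> ` {j. t < height N f j}" using j k by auto
    qed simp
    moreover have "inj_on \<sigma> {j. t < height N f j}"
      by (rule inj_on_subset[OF inj]) (use J in blast)
    then have "card (\<sigma> ` {j. t < height N f j}) = row mu t"
      using fun_cong[OF rows, of t] by (simp add: card_image rows_def)
    ultimately show ?thesis by simp
  qed
  define c where "c = inv_into J \<sigma>"
  have c: "c k \<in> J \<and> \<sigma> (c k) = k \<and> t < height N f (c k)" if "(t, k) \<in> cells mu" for t k
  proof -
    have "k \<in> \<sigma> ` {j. t < height N f j}" using that \<sigma> by (simp add: mem_cells_iff)
    then obtain j where j: "k = \<sigma> j" "t < height N f j" by blast
    then show ?thesis using J[OF j(2)] inj by (simp add: c_def)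
  qed
  have "\<forall>j. \<exists>e. bij_betw e {..<height N f j} {x \<in> {1..N}. f x = j}"
    unfolding height_def using ex_bij_betw_nat_finite[of "{x \<in> {1..N}. f x = j}" for j]
    by (simp add: lessThan_atLeast0)
  then obtain e where e: "\<And>j. bij_betw (e j) {..<height N f j} {x \<in> {1..N}. f x = j}"
    by metis
  define T where "T = (\<lambda>(i, k). e (c k) i)"
  have fT: "T (i, k) \<in> {1..N} \<and> f (T (i, k)) = c k" if "(i, k) \<in> cells mu" for i k
    using bij_betwE[OF e[of "c k"]] c[OF that] by (auto simp: T_def)
  have "is_tableau mu T"
    unfolding is_tableau_def
  proof (rule bij_betwI')
    have N: "sum_list mu = N" using mu by (simp add: is_partition_def)
    show "T x \<in> {1..sum_list mu}" if "x \<in> cells mu" for x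
      using fT[of "fst x" "snd x"] that N by simp
    show "\<exists>y\<in>cells mu. x = T y" if "x \<in> {1..sum_list mu}" for x
    proof -
      have "x \<in> e (f x) ` {..<height N f (f x)}"
        using e[of "f x"] that N by (auto simp: bij_betw_def)
      then obtain i where i: "i < height N f (f x)" "x = e (f x) i" by blast
      \<comment> \<open>The column of \<open>x\<close> is the rank of its class, the row its
        position within the class.\<close>
      have "\<sigma> (f x) \<in> {..<row mu i}" using i(1) \<sigma> by blast
      then have "(i, \<sigma> (f x)) \<in> cells mu" by (simp add: mem_cells_iff)
      moreover have "T (i, \<sigma> (f x)) = x"
        using i inj J[OF i(1)] by (simp add: T_def c_def)
      ultimately show ?thesis by metis
    qed
    show "(T x = T y) = (x = y)" if xy: "x \<in> cells mu" "y \<in> cells mu" for x y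
    proof
      obtain i k i' k' where eq: "x = (i, k)" "y = (i', k')" by (cases x, cases y)
      assume "T x = T y"
      then have *: "T (i, k) = T (i', k')" using eq by simp
      have mem: "(i, k) \<in> cells mu" "(i', k') \<in> cells mu" using xy eq by auto
      have "c k = c k'" using fT[OF mem(1)] fT[OF mem(2)] * by simp
      then have k: "k = k'" using c[OF mem(1)] c[OF mem(2)] by metis
      have "i = i'"
        using * c[OF mem(1)] c[OF mem(2)] e[of "c k"] k
        by (auto simp: T_def bij_betw_def dest: inj_onD)
      with k eq show "x = y" by simp
    qed simp
  qed
  moreover have "inj_on c (snd ` cells mu)"
  proof (rule inj_onI)
    fix x y assume "x \<in> snd ` cells mu" "y \<in> snd ` cells mu" "c x = c y"
    then obtain i i' where "(i, x) \<in> cells mu" "(i', y) \<in> cells mu" by force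
    from c[OF this(1)] c[OF this(2)] \<open>c x = c y\<close> show "x = y" by metis
  qed
  ultimately show ?thesis using that fT by blast
qed

lemma Var_eq_iff [simp]: "(Var i :: 'k::field mpoly) = Var j \<longleftrightarrow> i = j"
proof
  assume "(Var i :: 'k mpoly) = Var j"
  then have "mpoly_eval (\<lambda>k. if k = i then 1 else 0) (Var i :: 'k mpoly) =
    mpoly_eval (\<lambda>k. if k = i then 1 else 0) (Var j)" by simp
  then show "i = j" by (simp split: if_splits)
qed simp

lemma specht_poly_closed:
  assumes "is_tableau mu T"
  shows "specht_poly mu T \<in> carrier (mpoly_ring (sum_list mu))"
proof -
  have "Var (T (i, j)) \<in> carrier (mpoly_ring (sum_list mu))" if "(i, j) \<in> cells mu" for i j
    using assms that unfolding is_tableau_def by (intro mpoly_Var_closed) (metis bij_betwE)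
  then show ?thesis
    unfolding specht_poly_def by (auto intro!: mpoly_prod_closed mpoly_diff_closed)
qed

lemma specht_gens_closed:
  "{specht_poly mu T | T. is_tableau mu T} \<subseteq> carrier (mpoly_ring (sum_list mu))"
  using specht_poly_closed by blast

lemma ideal_specht_ideal: "ideal (specht_ideal mu) (mpoly_ring (sum_list mu))"
  unfolding specht_ideal_def by (rule ideal_genideal_mpoly[OF specht_gens_closed])

lemma specht_ideal_self: "is_tableau mu T \<Longrightarrow> specht_poly mu T \<in> specht_ideal mu"
  unfolding specht_ideal_def using genideal_mpoly_self[OF specht_gens_closed[of mu]] by blast

text \<open>Labelling entries by their columns turns a Specht polynomial of shape \<open>mu\<close>
  into a \<open>class_poly\<close>. By \<open>class_poly_mem\<close> it suffices to treat labellings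
  with the row lengths of \<open>mu'\<close>, and these come from tableaux of shape
  \<open>mu'\<close>.\<close>

lemma specht_ideal_mono:
  assumes mu: "is_partition mu N" and mu': "is_partition mu' N" and dom: "dominated_by mu mu'"
  shows "(specht_ideal mu :: 'k::field mpoly set) \<subseteq> specht_ideal mu'"
proof -
  let ?J = "specht_ideal mu' :: 'k mpoly set"
  have N: "sum_list mu = N" "sum_list mu' = N"
    using mu mu' by (simp_all add: is_partition_def)
  have J: "ideal ?J (mpoly_ring N)"
    using ideal_specht_ideal[of mu'] N by simp
  have sgnJ: "p \<in> ?J" if "sgn_eq p q" "q \<in> ?J" for p q
    using that mpoly_ideal_uminus[OF J] by (auto simp: sgn_eq_def)
  have "specht_poly mu T \<in> ?J" if T: "is_tableau mu T" for T
  proof -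
    define f where "f x = snd (inv_into (cells mu) T x)" for x
    have fT: "f (T (i, j)) = j" if "(i, j) \<in> cells mu" for i j
      using T that by (simp add: f_def is_tableau_def bij_betw_def)
    have rows: "rows N f = row mu" by (rule rows_tableau[OF mu T fT])
    have "class_poly N (Var :: nat \<Rightarrow> 'k mpoly) f \<in> ?J"
    proof (rule class_poly_mem[where \<rho> = "row mu'"])
      show "inj_on (Var :: nat \<Rightarrow> 'k mpoly) {1..N}" by (simp add: inj_on_def)
      show "antimono (row mu')" by (rule antimono_row[OF mu'])
      show "(\<Sum>s<t. row mu' s) = N" if "N \<le> t" for t by (rule sum_row_ge[OF mu' that])
      show "class_poly N Var g \<in> ?J" if g: "rows N g = row mu'" for g
      proof -
        obtain T' c where "is_tableau mu' T'" "inj_on c (snd ` cells mu')"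
          "\<And>i j. (i, j) \<in> cells mu' \<Longrightarrow> g (T' (i, j)) = c j"
          by (rule tableau_of_rows[OF mu' g]) blast
        then have "sgn_eq (specht_poly mu' T') (class_poly N Var g :: 'k mpoly)" "is_tableau mu' T'"
          using specht_poly_class_poly[of mu' T' c g] N by simp_all
        then show ?thesis using sgnJ[OF sgn_eq_sym specht_ideal_self] by blast
      qed
      show "0 \<in> ?J" by (rule mpoly_ideal_zero[OF J])
      show "p + q \<in> ?J" if "p \<in> ?J" "q \<in> ?J" for p q by (rule mpoly_ideal_add[OF J that])
      show "e * Var x ^ k * p \<in> ?J" if "e \<in> {1, -1}" "x \<in> {1..N}" "p \<in> ?J" for e x k p
        using mpoly_power_closed[OF mpoly_Var_closed[OF that(2)], of k] that(1)
        by (intro mpoly_ideal_mult[OF J that(3)]) auto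
      show "(\<Sum>s<t. rows N f s) \<le> (\<Sum>s<t. row mu' s)" for t
        using dom by (simp add: dominated_by_def rows sum_list_take_eq)
    qed
    moreover have "sgn_eq (specht_poly mu T) (class_poly N Var f :: 'k mpoly)"
      using specht_poly_class_poly[of mu T "\<lambda>j. j" f] T fT N by simp
    ultimately show ?thesis by (rule sgnJ[rotated])
  qed
  then show ?thesis
    unfolding specht_ideal_def[of mu] N by (intro genideal_mpoly_minimal[OF J]) blast
qed

section \<open>Dominance by counting entries column by column\<close>

lemma card_eq_sum_columns:
  assumes "finite C" "Y \<subseteq> C"
  shows "card Y = (\<Sum>j\<in>snd ` C. card {i. (i, j) \<in> Y})"
proof -
  have fin: "finite {i. (i, j) \<in> Y}" for j
    by (rule finite_subset[of _ "fst ` C"]) (use assms in force)+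
  have "Y = (\<lambda>(j, i). (i, j)) ` Sigma (snd ` C) (\<lambda>j. {i. (i, j) \<in> Y})"
    using assms by force
  also have "card \<dots> = card (Sigma (snd ` C) (\<lambda>j. {i. (i, j) \<in> Y}))"
    by (rule card_image) (auto simp: inj_on_def)
  also have "\<dots> = (\<Sum>j\<in>snd ` C. card {i. (i, j) \<in> Y})"
    using assms fin by (subst card_SigmaI) auto
  finally show ?thesis .
qed

text \<open>The first \<open>t\<close> rows of \<open>mu\<close> hold exactly the entries with
  \<open>b\<close> below \<open>t\<close>. In \<open>T\<close> each column contains at most
  \<open>t\<close> of them and at most as many as it has cells, hence no more than it has cells in
  the first \<open>t\<close> rows of \<open>mu'\<close>.\<close>

lemma dominated_by_of_column_distinct:
  assumes mu: "is_partition mu N" and mu': "is_partition mu' N"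
    and T0: "is_tableau mu T0" and T: "is_tableau mu' T"
    and b: "\<And>i j. (i, j) \<in> cells mu \<Longrightarrow> b (T0 (i, j)) = i"
    and distinct: "\<And>i i' j. i < i' \<Longrightarrow> (i, j) \<in> cells mu' \<Longrightarrow> (i', j) \<in> cells mu' \<Longrightarrow>
      b (T (i, j)) \<noteq> b (T (i', j))"
  shows "dominated_by mu mu'"
  unfolding dominated_by_def sum_list_take_eq
proof
  fix t
  have bij0: "inj_on T0 (cells mu)" "T0 ` cells mu = {1..N}"
    and bij: "inj_on T (cells mu')" "T ` cells mu' = {1..N}"
    using T0 T mu mu' by (auto simp: is_tableau_def bij_betw_def is_partition_def)
  define Y where "Y = {c \<in> cells mu'. b (T c) < t}"
  define Z where "Z = {(i, j). (i, j) \<in> cells mu' \<and> i < t}"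
  have "(\<Sum>s<t. row mu s) = card {(i, j). (i, j) \<in> cells mu \<and> i < t}"
    by (simp only: card_cells_less)
  also have "\<dots> = card (T0 ` {(i, j). (i, j) \<in> cells mu \<and> i < t})"
    by (rule card_image[symmetric], rule inj_on_subset[OF bij0(1)]) auto
  also have "T0 ` {(i, j). (i, j) \<in> cells mu \<and> i < t} = {x \<in> T0 ` cells mu. b x < t}"
    using b by force
  also have "\<dots> = T ` Y"
    unfolding bij0(2) bij(2)[symmetric] Y_def by auto
  also have "card \<dots> = card Y"
    by (rule card_image, rule inj_on_subset[OF bij(1)]) (simp add: Y_def)
  also have "\<dots> = (\<Sum>j\<in>snd ` cells mu'. card {i. (i, j) \<in> Y})"
    by (rule card_eq_sum_columns) (auto simp: Y_def)
  also have "\<dots> \<le> (\<Sum>j\<in>snd ` cells mu'. card {i. (i, j) \<in> Z})"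
  proof (rule sum_mono)
    fix j
    obtain m where m: "{i. (i, j) \<in> cells mu'} = {..<m}"
      using column_eq_lessThan[OF mu'] by blast
    have Yj: "{i. (i, j) \<in> Y} \<subseteq> {..<m}" unfolding m[symmetric] by (auto simp: Y_def)
    have "{i. (i, j) \<in> Z} = {i. (i, j) \<in> cells mu'} \<inter> {..<t}"
      by (auto simp: Z_def)
    also have "\<dots> = {..<min m t}"
      unfolding m by (rule Set.set_eqI) simp
    finally have Zj: "{i. (i, j) \<in> Z} = {..<min m t}" .
    have "card {i. (i, j) \<in> Y} \<le> m" using card_mono[OF _ Yj] by simp
    moreover have "card {i. (i, j) \<in> Y} \<le> card {..<t}"
    proof (rule card_inj_on_le)
      show "inj_on (\<lambda>i. b (T (i, j))) {i. (i, j) \<in> Y}"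
      proof (rule inj_onI)
        fix x y assume "x \<in> {i. (i, j) \<in> Y}" "y \<in> {i. (i, j) \<in> Y}" "b (T (x, j)) = b (T (y, j))"
        then show "x = y"
          using distinct[of x y j] distinct[of y x j] by (cases x y rule: linorder_cases) (auto simp: Y_def)
      qed
      show "(\<lambda>i. b (T (i, j))) ` {i. (i, j) \<in> Y} \<subseteq> {..<t}" by (auto simp: Y_def)
    qed simp
    ultimately show "card {i. (i, j) \<in> Y} \<le> card {i. (i, j) \<in> Z}"
      unfolding Zj by simp
  qed
  also have "\<dots> = card Z"
    by (rule card_eq_sum_columns[symmetric]) (auto simp: Z_def)
  also have "\<dots> = (\<Sum>s<t. row mu' s)"
    unfolding Z_def by (rule card_cells_less)
  finally show "(\<Sum>s<t. row mu s) \<le> (\<Sum>s<t. row mu' s)" .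
qed

section \<open>The ideals of pairs\<close>

lemma phi_closed:
  assumes S: "S \<subseteq> {1..n}" and p: "p \<in> carrier (mpoly_ring (card S))"
  shows "phi r S p \<in> carrier (mpoly_ring n)"
  unfolding phi_def
proof (rule mpoly_subst_closed[OF p])
  fix i assume i: "i \<in> {1..card S}"
  have fin: "finite S" using S finite_subset by blast
  have "sorted_list_of_set S ! (i - 1) \<in> set (sorted_list_of_set S)"
    by (rule nth_mem) (use i fin in auto)
  then have "sorted_list_of_set S ! (i - 1) \<in> {1..n}"
    using S fin by auto
  then show "Var (sorted_list_of_set S ! (i - 1)) ^ r \<in> carrier (mpoly_ring n)"
    by (intro mpoly_power_closed mpoly_Var_closed)
qed

text \<open>The increasing enumeration of \<open>{1..N}\<close> is the identity. This case suffices
  because the test point below has its zeros at the end.\<close>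

lemma mpoly_eval_phi:
  assumes "p \<in> carrier (mpoly_ring N)"
  shows "mpoly_eval a (phi r {1..N} p) = mpoly_eval (\<lambda>j. a j ^ r) p"
  unfolding phi_def mpoly_eval_subst
proof (rule mpoly_eval_cong[OF assms])
  fix i assume i: "i \<in> {1..N}"
  have "sorted_list_of_set {1..N} = [1..<Suc N]"
    by (simp only: atLeastLessThanSuc_atLeastAtMost[symmetric] sorted_list_of_set_range)
  moreover have "[1..<Suc N] ! (i - 1) = i"
    using i by (subst nth_upt) auto
  ultimately show "mpoly_eval a (Var (sorted_list_of_set {1..N} ! (i - 1)) ^ r) = a i ^ r"
    by simp
qed

lemma X_gens_closed: "Var ` ({1..n} - S) \<subseteq> carrier (mpoly_ring n)"
  by (rule image_subsetI, rule mpoly_Var_closed) blast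

lemma ideal_X_ideal: "ideal (X_ideal n S) (mpoly_ring n)"
  unfolding X_ideal_def by (rule ideal_genideal_mpoly[OF X_gens_closed])

lemma Var_mem_X_ideal: "i \<in> {1..n} - S \<Longrightarrow> Var i \<in> X_ideal n S"
  unfolding X_ideal_def using genideal_mpoly_self[OF X_gens_closed[of n S]] by blast

definition local_ideal :: "nat \<Rightarrow> nat \<Rightarrow> nat list \<Rightarrow> nat set \<Rightarrow> 'k::comm_ring_1 mpoly set" where
  "local_ideal r n mu S = genideal (mpoly_ring n) (X_ideal n S \<union> phi r S ` specht_ideal mu)"

lemma I_ideal_eq:
  "I_ideal r n (mu, z) =
    (\<Inter>S \<in> {S. S \<subseteq> {1..n} \<and> card S = n - z}. local_ideal r n mu S) \<inter> many_zeros_ideal n z"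
  by (simp add: I_ideal_def local_ideal_def)

lemma local_gens_closed:
  assumes "S \<subseteq> {1..n}" "card S = sum_list mu"
  shows "X_ideal n S \<union> phi r S ` specht_ideal mu \<subseteq> carrier (mpoly_ring n)"
proof -
  have "p \<in> carrier (mpoly_ring n)" if "p \<in> X_ideal n S" for p
    by (rule ideal.Icarr[OF ideal_X_ideal that])
  moreover have "phi r S p \<in> carrier (mpoly_ring n)" if "p \<in> specht_ideal mu" for p
    by (rule phi_closed[OF assms(1)]) (simp only: assms(2) ideal.Icarr[OF ideal_specht_ideal that])
  ultimately show ?thesis by blast
qed

lemma
  assumes "S \<subseteq> {1..n}" "card S = sum_list mu"
  shows ideal_local_ideal: "ideal (local_ideal r n mu S) (mpoly_ring n)"
    and local_ideal_self: "X_ideal n S \<union> phi r S ` specht_ideal mu \<subseteq> local_ideal r n mu S"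
  unfolding local_ideal_def
  by (rule ideal_genideal_mpoly[OF local_gens_closed[OF assms]],
      rule genideal_mpoly_self[OF local_gens_closed[OF assms]])

lemma prod_Var_closed:
  "A \<subseteq> {1..n} \<Longrightarrow> (\<Prod>i\<in>A. Var i) \<in> carrier (mpoly_ring n)"
  by (intro mpoly_prod_closed mpoly_Var_closed) blast

lemma many_zeros_gens_closed:
  "{\<Prod>i\<in>A. Var i | A. A \<subseteq> {1..n} \<and> card A = n - z} \<subseteq> carrier (mpoly_ring n)"
  using prod_Var_closed by blast

lemma ideal_many_zeros_ideal: "ideal (many_zeros_ideal n z) (mpoly_ring n)"
  unfolding many_zeros_ideal_def by (rule ideal_genideal_mpoly[OF many_zeros_gens_closed])

lemma many_zeros_ideal_self:
  "A \<subseteq> {1..n} \<Longrightarrow> card A = n - z \<Longrightarrow> (\<Prod>i\<in>A. Var i) \<in> many_zeros_ideal n z"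
  unfolding many_zeros_ideal_def using genideal_mpoly_self[OF many_zeros_gens_closed[of n z]] by blast

lemma many_zeros_ideal_minimal:
  assumes "ideal J (mpoly_ring n)"
    and "\<And>A. A \<subseteq> {1..n} \<Longrightarrow> card A = n - z \<Longrightarrow> (\<Prod>i\<in>A. Var i) \<in> J"
  shows "many_zeros_ideal n z \<subseteq> J"
  unfolding many_zeros_ideal_def using assms(2) by (intro genideal_mpoly_minimal[OF assms(1)]) blast

lemma prod_Var_mem:
  assumes J: "ideal J (mpoly_ring n)" and A: "A \<subseteq> {1..n}" and B: "B \<subseteq> A" "(\<Prod>i\<in>B. Var i) \<in> J"
  shows "(\<Prod>i\<in>A. Var i) \<in> J"
proof -
  have "finite A" using A finite_subset by blast
  then have "(\<Prod>i\<in>A. Var i) = (\<Prod>i\<in>A - B. Var i) * (\<Prod>i\<in>B. Var i :: 'a mpoly)"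
    by (rule prod.subset_diff[OF B(1)])
  moreover have "(\<Prod>i\<in>A - B. Var i) \<in> carrier (mpoly_ring n)"
    by (rule prod_Var_closed) (use A in blast)
  ultimately show ?thesis
    using mpoly_ideal_mult[OF J B(2)] by simp
qed

text \<open>More zeros mean shorter monomials, and each longer monomial is a multiple of a shorter
  one.\<close>

lemma many_zeros_ideal_mono:
  assumes "z \<le> z'"
  shows "many_zeros_ideal n z \<subseteq> many_zeros_ideal n z'"
proof (rule many_zeros_ideal_minimal[OF ideal_many_zeros_ideal])
  fix A assume A: "A \<subseteq> {1..n}" "card A = n - z"
  have "n - z' \<le> card A" using A assms by simp
  then obtain B where B: "B \<subseteq> A" "card B = n - z'"
    by (rule obtain_subset_with_card_n)
  show "(\<Prod>i\<in>A. Var i) \<in> many_zeros_ideal n z'"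
    by (rule prod_Var_mem[OF ideal_many_zeros_ideal A(1) B(1)], rule many_zeros_ideal_self)
      (use A B in auto)
qed

text \<open>The product is a multiple of a variable with index outside \<open>S\<close>, and these
  generate \<open>X_ideal n S\<close>.\<close>

lemma prod_Var_mem_local_ideal:
  assumes S: "S \<subseteq> {1..n}" "card S = sum_list mu" and A: "A \<subseteq> {1..n}" "\<not> A \<subseteq> S"
  shows "(\<Prod>i\<in>A. Var i) \<in> local_ideal r n mu S"
proof -
  obtain i where i: "i \<in> A" "i \<notin> S" using A(2) by blast
  have "Var i \<in> X_ideal n S" by (rule Var_mem_X_ideal) (use i A in blast)
  then have "Var i \<in> local_ideal r n mu S" using local_ideal_self[OF S] by blast
  then show ?thesis
    using i by (intro prod_Var_mem[OF ideal_local_ideal[OF S] A(1), of "{i}"]) simp_all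
qed

lemma I_ideal_mono:
  assumes "z' \<le> n" and mu: "is_partition mu (n - z)" and mu': "is_partition mu' (n - z')"
    and dom: "pair_dominates (mu, z) (mu', z')"
  shows "(I_ideal r n (mu, z) :: 'k::field mpoly set) \<subseteq> I_ideal r n (mu', z')"
proof (cases "z < z'")
  case True
  have "many_zeros_ideal n z \<subseteq> local_ideal r n mu' S"
    if S: "S \<subseteq> {1..n}" "card S = n - z'" for S
  proof (rule many_zeros_ideal_minimal)
    have S': "card S = sum_list mu'" using S mu' by (simp add: is_partition_def)
    show "ideal (local_ideal r n mu' S) (mpoly_ring n)" by (rule ideal_local_ideal[OF S(1) S'])
    fix A assume A: "A \<subseteq> {1..n}" "card A = n - z"
    \<comment> \<open>\<open>A\<close> has more elements than \<open>S\<close>: since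
      \<open>z' \<le> n\<close>, the truncated differences satisfy
      \<open>n - z' < n - z\<close>.\<close>
    have "\<not> A \<subseteq> S"
      using card_mono[OF finite_subset[OF S(1)], of A] A(2) S(2) True assms(1) by auto
    with A show "(\<Prod>i\<in>A. Var i) \<in> local_ideal r n mu' S"
      by (intro prod_Var_mem_local_ideal[OF S(1) S'])
  qed
  moreover have "many_zeros_ideal n z \<subseteq> many_zeros_ideal n z'"
    by (rule many_zeros_ideal_mono) (use True in simp)
  ultimately show ?thesis unfolding I_ideal_eq by blast
next
  case False
  with dom have z: "z = z'" and dom: "dominated_by mu mu'" by (auto simp: pair_dominates_def)
  have sub: "(specht_ideal mu :: 'k mpoly set) \<subseteq> specht_ideal mu'"
    by (rule specht_ideal_mono[OF mu _ dom]) (use mu' z in simp)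
  have "(local_ideal r n mu S :: 'k mpoly set) \<subseteq> local_ideal r n mu' S"
    if S: "S \<subseteq> {1..n}" "card S = n - z" for S
    unfolding local_ideal_def
  proof (rule genideal_mpoly_mono)
    show "X_ideal n S \<union> phi r S ` specht_ideal mu' \<subseteq> carrier (mpoly_ring n)"
      by (rule local_gens_closed) (use S mu' z in \<open>auto simp: is_partition_def\<close>)
  qed (use sub in blast)
  then show ?thesis unfolding I_ideal_eq z[symmetric] by blast
qed

section \<open>From zero sets back to the order on pairs\<close>

lemma zero_set_antimono: "I \<subseteq> J \<Longrightarrow> zero_set n J \<subseteq> zero_set n I"
  by (auto simp: zero_set_def)

text \<open>A field element has only finitely many \<open>r\<close>-th roots, so an infinite field
  has infinitely many nonzero \<open>r\<close>-th powers. The sequence \<open>s\<close> picks a root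
  for each member of a sequence of distinct powers.\<close>

lemma ex_distinct_powers:
  assumes "0 < r" "infinite (UNIV :: 'k::field set)"
  obtains s :: "nat \<Rightarrow> 'k::field" where "\<And>i. s i \<noteq> 0" "inj (\<lambda>i. s i ^ r)"
proof -
  have "infinite ((\<lambda>x::'k. x ^ r) ` (UNIV - {0}))"
  proof
    assume "finite ((\<lambda>x::'k. x ^ r) ` (UNIV - {0}))"
    moreover have "infinite (UNIV - {0::'k})" using assms(2) by simp
    ultimately obtain x0 where "infinite {x \<in> UNIV - {0::'k}. x ^ r = x0 ^ r}"
      using pigeonhole_infinite by blast
    moreover have "{x \<in> UNIV - {0::'k}. x ^ r = x0 ^ r} \<subseteq> {x. poly (monom 1 r - [:x0 ^ r:]) x = 0}"
      by (auto simp: poly_monom)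
    \<comment> \<open>As \<open>r > 0\<close>, the constant term does not affect the coefficient at
      \<open>r\<close>, so the polynomial is nonzero and has finitely many roots.\<close>
    moreover have "coeff (monom 1 r - [:x0 ^ r:]) r = 1"
      using assms(1) by (cases r) (simp_all add: coeff_pCons)
    then have "monom 1 r - [:x0 ^ r:] \<noteq> 0" by (metis coeff_0 zero_neq_one)
    ultimately show False using poly_roots_finite finite_subset by blast
  qed
  then obtain f :: "nat \<Rightarrow> 'k" where f: "inj f" "range f \<subseteq> (\<lambda>x. x ^ r) ` (UNIV - {0})"
    using infinite_countable_subset by blast
  have "\<exists>x. x \<noteq> 0 \<and> f i = x ^ r" for i
    using subsetD[OF f(2) rangeI[of f i]] by auto
  then obtain s where s: "\<And>i. s i \<noteq> 0 \<and> f i = s i ^ r" by metis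
  with f(1) that[of s] show ?thesis by (simp add: inj_def)
qed

lemma mpoly_eval_specht_poly:
  "mpoly_eval a (specht_poly mu T) =
    (\<Prod>j \<in> snd ` cells mu.
       \<Prod>(i, i') \<in> {(i, i'). i < i' \<and> (i, j) \<in> cells mu \<and> (i', j) \<in> cells mu}.
         a (T (i, j)) - a (T (i', j)))"
  by (simp add: specht_poly_def case_prod_beta)

lemma mpoly_eval_specht_poly_eq_0_iff:
  fixes a :: "nat \<Rightarrow> 'k::field"
  shows "mpoly_eval a (specht_poly mu T) = 0 \<longleftrightarrow>
    (\<exists>i i' j. i < i' \<and> (i, j) \<in> cells mu \<and> (i', j) \<in> cells mu \<and> a (T (i, j)) = a (T (i', j)))"
proof -
  have fin: "finite {(i, i'). i < i' \<and> (i, j) \<in> cells mu \<and> (i', j) \<in> cells mu}" for j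
    by (rule finite_subset[of _ "fst ` cells mu \<times> fst ` cells mu"]) force+
  define Q where "Q j \<longleftrightarrow>
    (\<exists>i i'. i < i' \<and> (i, j) \<in> cells mu \<and> (i', j) \<in> cells mu \<and> a (T (i, j)) = a (T (i', j)))" for j
  have "(\<Prod>(i, i') \<in> {(i, i'). i < i' \<and> (i, j) \<in> cells mu \<and> (i', j) \<in> cells mu}.
      a (T (i, j)) - a (T (i', j))) = 0 \<longleftrightarrow> Q j" for j
    unfolding prod_zero_iff[OF fin] Q_def by auto
  then have "mpoly_eval a (specht_poly mu T) = 0 \<longleftrightarrow> (\<exists>j\<in>snd ` cells mu. Q j)"
    unfolding mpoly_eval_specht_poly by (simp only: prod_zero_iff[OF finite_imageI[OF finite_cells]])
  also have "\<dots> \<longleftrightarrow> (\<exists>j. Q j)"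
    unfolding Q_def by (metis image_eqI snd_conv)
  finally show ?thesis unfolding Q_def by blast
qed

text \<open>By contraposition: if the order fails, the point \<open>a\<close> is a zero of the ideal
  of \<open>(mu', z')\<close> but not of that of \<open>(mu, z)\<close>.\<close>

lemma pair_dominates_of_zero_set_subset:
  fixes r n z z' :: nat
  assumes r: "0 < r" and inf: "infinite (UNIV :: 'k::field set)"
    and "z \<le> n"
    and mu: "is_partition mu (n - z)" and mu': "is_partition mu' (n - z')"
    and sub: "zero_set n (I_ideal r n (mu', z') :: 'k mpoly set) \<subseteq> zero_set n (I_ideal r n (mu, z))"
  shows "pair_dominates (mu, z) (mu', z')"
proof (rule ccontr)
  assume not_dom: "\<not> pair_dominates (mu, z) (mu', z')"
  define N where "N = n - z"
  have S: "{1..N} \<subseteq> {1..n}" "card {1..N} = n - z" "card {1..N} = sum_list mu" "sum_list mu = N"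
    using mu by (auto simp: N_def is_partition_def)
  obtain T0 where T0: "is_tableau mu T0" using ex_tableau by blast
  have bij0: "inj_on T0 (cells mu)" "T0 ` cells mu = {1..N}"
    using T0 S(4) by (auto simp: is_tableau_def bij_betw_def)
  obtain s :: "nat \<Rightarrow> 'k" where s0: "\<And>i. s i \<noteq> 0" and s: "inj (\<lambda>i. s i ^ r)"
    using ex_distinct_powers[OF r inf] by blast
  define b where "b x = fst (inv_into (cells mu) T0 x)" for x
  have b: "b (T0 (i, j)) = i" if "(i, j) \<in> cells mu" for i j
    using that bij0(1) by (simp add: b_def)
  \<comment> \<open>The last \<open>z\<close> coordinates vanish. Two of the others have equal
    \<open>r\<close>-th powers exactly when their indices share a row of \<open>T0\<close>, so row
    \<open>i\<close> gives a value of multiplicity \<open>mu ! i\<close>.\<close>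
  define a where "a = (\<lambda>i\<in>{1..n}. if i \<le> N then s (b i) else 0)"
  have a_in: "a x = s (b x)" if "x \<in> {1..N}" for x
    using that S(1) by (auto simp: a_def)
  have a_out: "a x = 0" if "x \<in> {1..n}" "x \<notin> {1..N}" for x
    using that by (auto simp: a_def)
  have pow_eq: "a x ^ r = a y ^ r \<longleftrightarrow> b x = b y" if "x \<in> {1..N}" "y \<in> {1..N}" for x y
    using injD[OF s, of "b x" "b y"] by (auto simp: a_in[OF that(1)] a_in[OF that(2)])
  have "a \<notin> zero_set n (I_ideal r n (mu, z) :: 'k mpoly set)"
  proof
    assume a: "a \<in> zero_set n (I_ideal r n (mu, z) :: 'k mpoly set)"
    let ?q = "specht_poly mu T0 :: 'k mpoly"
    let ?p = "phi r {1..N} ?q"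
    have q: "?q \<in> carrier (mpoly_ring N)" using specht_poly_closed[OF T0] S(4) by simp
    have p: "?p \<in> carrier (mpoly_ring n)" using phi_closed[OF S(1), of ?q r] q by simp
    \<comment> \<open>The factor \<open>?p\<close> accounts for the set \<open>{1..N}\<close>. Any
      other set of the same size misses some index in \<open>{1..N}\<close>, so there the monomial
      suffices.\<close>
    have "?p * (\<Prod>i\<in>{1..N}. Var i) \<in> local_ideal r n mu S'"
      if S': "S' \<subseteq> {1..n}" "card S' = n - z" for S'
    proof (cases "S' = {1..N}")
      case True
      have "?p \<in> local_ideal r n mu {1..N}"
        using local_ideal_self[OF S(1,3), of r] specht_ideal_self[OF T0] by blast
      from mpoly_ideal_mult[OF ideal_local_ideal[OF S(1,3)] this prod_Var_closed[OF S(1)]]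
      show ?thesis unfolding True by (simp only: mult.commute)
    next
      case False
      have S'': "card S' = sum_list mu" using S' S by simp
      have "\<not> {1..N} \<subseteq> S'"
        using card_subset_eq[OF finite_subset[OF S'(1)], of "{1..N}"] False S'(2) S(2) by auto
      then show ?thesis
        by (intro mpoly_ideal_mult[OF ideal_local_ideal[OF S'(1) S''] _ p]
          prod_Var_mem_local_ideal[OF S'(1) S'' S(1)])
    qed
    moreover have "?p * (\<Prod>i\<in>{1..N}. Var i) \<in> many_zeros_ideal n z"
      by (rule mpoly_ideal_mult[OF ideal_many_zeros_ideal many_zeros_ideal_self[OF S(1,2)] p])
    ultimately have "?p * (\<Prod>i\<in>{1..N}. Var i) \<in> I_ideal r n (mu, z)"
      unfolding I_ideal_eq by blast
    with a have "mpoly_eval a (?p * (\<Prod>i\<in>{1..N}. Var i)) = 0"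
      unfolding zero_set_def by blast
    then have "mpoly_eval (\<lambda>j. a j ^ r) ?q = 0 \<or> (\<Prod>i\<in>{1..N}. a i) = 0"
      by (simp only: mpoly_eval_mult mpoly_eval_phi[OF q] mpoly_eval_prod mpoly_eval_Var mult_eq_0_iff)
    moreover have "(\<Prod>i\<in>{1..N}. a i) \<noteq> 0"
      using s0 a_in by (simp add: prod_zero_iff)
    ultimately obtain i i' j where "i < i'" "(i, j) \<in> cells mu" "(i', j) \<in> cells mu"
      "a (T0 (i, j)) ^ r = a (T0 (i', j)) ^ r"
      unfolding mpoly_eval_specht_poly_eq_0_iff by blast
    moreover from this have "T0 (i, j) \<in> {1..N}" "T0 (i', j) \<in> {1..N}" using bij0(2) by blast+
    \<comment> \<open>Cells of one column of \<open>T0\<close> lie in different rows, so the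
      \<open>r\<close>-th powers at their entries differ.\<close>
    ultimately show False using pow_eq b by auto
  qed
  moreover have "a \<in> zero_set n (I_ideal r n (mu', z') :: 'k mpoly set)"
  proof -
    let ?V = "{p \<in> carrier (mpoly_ring n). \<forall>c\<in>{a}. mpoly_eval c p = 0} :: 'k mpoly set"
    have V: "ideal ?V (mpoly_ring n)" by (rule ideal_vanishing)
    have "I_ideal r n (mu', z') \<subseteq> ?V"
    proof (cases "z' < z")
      \<comment> \<open>Each monomial has degree \<open>n - z'\<close>, which exceeds
        \<open>N\<close>, so it contains a variable that vanishes at \<open>a\<close>.\<close>
      case True
      have "many_zeros_ideal n z' \<subseteq> ?V"
      proof (rule many_zeros_ideal_minimal[OF V])
        fix A assume A: "A \<subseteq> {1..n}" "card A = n - z'"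
        have "\<not> A \<subseteq> {1..N}"
          using card_mono[of "{1..N}" A] A(2) S(2) True assms(3) by auto
        then obtain i where "i \<in> A" "i \<notin> {1..N}" by blast
        moreover from this have "a i = 0" using A(1) by (intro a_out) blast+
        moreover have "finite A" using A(1) finite_subset by blast
        ultimately have "(\<Prod>i\<in>A. a i) = 0" by (intro prod_zero) blast+
        then show "(\<Prod>i\<in>A. Var i) \<in> ?V" using prod_Var_closed[OF A(1)] by simp
      qed
      then show ?thesis unfolding I_ideal_eq by blast
    next
      case False
      \<comment> \<open>Here \<open>z \<le> z'\<close>, so failure of the order leaves equality
        without dominance. It is enough that the component of the intersection for
        \<open>{1..N}\<close>, the support of \<open>a\<close>, vanishes at
        \<open>a\<close>.\<close>
      with not_dom have z: "z' = z" and nd: "\<not> dominated_by mu mu'"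
        by (auto simp: pair_dominates_def)
      have mu'N: "is_partition mu' N" using mu' z by (simp add: N_def)
      have S': "card {1..N} = sum_list mu'" "sum_list mu' = N"
        using mu'N by (simp_all add: is_partition_def)
      let ?W = "{p \<in> carrier (mpoly_ring N). \<forall>c\<in>{\<lambda>j. a j ^ r}. mpoly_eval c p = 0} :: 'k mpoly set"
      have "specht_poly mu' T \<in> ?W" if T: "is_tableau mu' T" for T
      proof -
        \<comment> \<open>The pigeonhole lemma contraposed: without dominance, every tableau of
          shape \<open>mu'\<close> repeats a value of \<open>b\<close> in some column.\<close>
        have "\<exists>i i' j. i < i' \<and> (i, j) \<in> cells mu' \<and> (i', j) \<in> cells mu' \<and> b (T (i, j)) = b (T (i', j))"
          using dominated_by_of_column_distinct[OF mu[folded N_def] mu'N T0 T, of b] b nd by blast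
        moreover have "T c \<in> {1..N}" if "c \<in> cells mu'" for c
          using T that S'(2) unfolding is_tableau_def by (metis bij_betwE)
        ultimately have "mpoly_eval (\<lambda>j. a j ^ r) (specht_poly mu' T) = 0"
          unfolding mpoly_eval_specht_poly_eq_0_iff using pow_eq by blast
        then show ?thesis using specht_poly_closed[OF T] S'(2) by simp
      qed
      then have W: "specht_ideal mu' \<subseteq> ?W"
        unfolding specht_ideal_def S'(2) by (intro genideal_mpoly_minimal[OF ideal_vanishing]) blast
      have "X_ideal n {1..N} \<subseteq> ?V"
        unfolding X_ideal_def
      proof (rule genideal_mpoly_minimal[OF V], rule image_subsetI)
        fix i assume i: "i \<in> {1..n} - {1..N}"
        then have "a i = 0" by (intro a_out) blast+
        moreover have "Var i \<in> carrier (mpoly_ring n)" using i by (intro mpoly_Var_closed) blast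
        ultimately show "Var i \<in> ?V" by simp
      qed
      moreover have "phi r {1..N} q \<in> ?V" if "q \<in> specht_ideal mu'" for q
      proof -
        have q: "q \<in> carrier (mpoly_ring N)" "mpoly_eval (\<lambda>j. a j ^ r) q = 0" using W that by auto
        then show ?thesis
          using phi_closed[OF S(1), of q r] mpoly_eval_phi[OF q(1), of a r] by simp
      qed
      ultimately have "local_ideal r n mu' {1..N} \<subseteq> ?V"
        unfolding local_ideal_def by (intro genideal_mpoly_minimal[OF V]) blast
      then show ?thesis unfolding I_ideal_eq z using S(1,2) by blast
    qed
    moreover have "a \<in> {1..n} \<rightarrow>\<^sub>E UNIV" by (simp add: a_def)
    ultimately show ?thesis unfolding zero_set_def by blast
  qed
  ultimately show False using sub by blast
qed

theorem theorem3p6: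
  fixes r n z z' :: nat and mu mu' :: "nat list"
  assumes "r \<ge> 2"
    and "infinite (UNIV :: 'k::field set)"
    and "contains_roots_of_unity TYPE('k) r"
    and "z \<le> n" and "z' \<le> n"
    and "is_partition mu (n - z)" and "is_partition mu' (n - z')"
  shows "(pair_dominates (mu, z) (mu', z') \<longleftrightarrow>
            (I_ideal r n (mu, z) :: 'k mpoly set) \<subseteq> I_ideal r n (mu', z'))
       \<and> ((I_ideal r n (mu, z) :: 'k mpoly set) \<subseteq> I_ideal r n (mu', z') \<longleftrightarrow>
            zero_set n (I_ideal r n (mu', z') :: 'k mpoly set) \<subseteq> zero_set n (I_ideal r n (mu, z)))"
proof -
  have "0 < r" using assms(1) by simp
  note dom_of_sub = pair_dominates_of_zero_set_subset[OF this assms(2,4,6,7)]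
  note sub_of_dom = I_ideal_mono[OF assms(5-7), where 'k = 'k and r = r]
  \<comment> \<open>The three implications form the cycle (i), (ii), (iii), (i).\<close>
  from dom_of_sub sub_of_dom zero_set_antimono show ?thesis by blast
qed

end
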